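(* Let $\beta\in[0,1)$, let $a,b,c\in\mathbb{R}$ satisfy either ($c=0$ and $a\neq b$) or ($c>0$ and $a<b$), and let $\nu\in\mathbb{R}$ with $Q(\nu)\neq 0$. Then the following hold. (a) If $\nu\geq\max\{0,\nu_0\}$ and $\nu\neq 0$, then the radius of starlikeness of order $\beta$, $r^{\ast}_{\beta}(f_\nu)$, is the smallest positive root of the equation $$ar^3J_\nu'''(r)+(2a+b-a\nu\beta)r^2J_\nu''(r)+(b+c-b\nu\beta)rJ_\nu'(r)-c\nu\beta J_\nu(r)=0.$$ (b) If $\nu\geq\max\{0,\nu_0\}$, then the radius of starlikeness of order $\beta$, $r^{\ast}_{\beta}(g_\nu)$, is the smallest positive root of the equation $$(1-\nu)+\frac{ar^3J_\nu'''(r)+(2a+b)r^2J_\nu''(r)+(b+c)rJ_\nu'(r)}{ar^2J_\nu''(r)+brJ_\nu'(r)+cJ_\nu(r)}=\beta.$$ (c) If $\nu\geq\max\{0,\nu_0\}$, then the radius of starlikeness of order $\beta$, $r^{\ast}_{\beta}(h_\nu)$, is the smallest positive root of the equation $$(2-\nu)+\frac{ar\sqrt{r}\,J_\nu'''(\sqrt{r})+(2a+b)rJ_\nu''(\sqrt{r})+(b+c)\sqrt{r}\,J_\nu'(\sqrt{r})}{arJ_\nu''(\sqrt{r})+b\sqrt{r}\,J_\nu'(\sqrt{r})+cJ_\nu(\sqrt{r})}=2\beta.$$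
   Context: $J_\nu(z)=\sum_{n\ge 0}\frac{(-1)^n}{n!\,\Gamma(n+\nu+1)}\left(\frac z2\right)^{2n+\nu}$ is the Bessel function of the first kind of order $\nu$. For real $a,b,c$ put $N_\nu(z)=az^2J_\nu''(z)+bzJ_\nu'(z)+cJ_\nu(z)$ and $Q(\nu)=a\nu(\nu-1)+b\nu+c$. $\nu_0$ denotes the largest real root of the quadratic $Q$ (if $Q$ has no real root, $\max\{0,\nu_0\}$ is read as $0$). Normalized functions (defined when $Q(\nu)\ne0$): $f_\nu(z)=\left[\frac{2^\nu\Gamma(\nu+1)}{Q(\nu)}N_\nu(z)\right]^{1/\nu}$ (for $\nu\neq0$; the branch analytic near $0$ with $f_\nu(0)=0$, $f_\nu'(0)=1$), $g_\nu(z)=\frac{2^\nu\Gamma(\nu+1)z^{1-\nu}}{Q(\nu)}N_\nu(z)$, and $h_\nu(z)=\frac{2^\nu\Gamma(\nu+1)z^{1-\nu/2}}{Q(\nu)}N_\nu(\sqrt z)$. Each is analytic near $0$ with value $0$ and derivative $1$ at $0$. $\mathbb{D}_r=\{z\in\mathbb{C}:|z|<r\}$. For $f$ analytic near $0$ with $f(0)=0,\ f'(0)=1$ and power series with radius of convergence $r_f\in(0,\infty]$, the radius of starlikeness of order $\beta$ is $r_\beta^{\ast}(f)=\sup\{r\in(0,r_f):\operatorname{Re}\left(\frac{zf'(z)}{f(z)}\right)>\beta\text{ for all }z\in\mathbb{D}_r\}$. *)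

theory Defs
  imports "HOL-Complex_Analysis.Complex_Analysis"
begin

text \<open>
  Bessel function of the first kind, on the principal branch (cut along the negative real axis
  unless \<open>\<nu>\<close> is an integer). The factor \<open>(z/2)\<close> to the power \<open>2n + \<nu>\<close> is split so that only
  \<open>\<nu>\<close> needs a branch; the case \<open>\<nu> = 0\<close> is separate only because \<open>0 powr 0 = 0\<close> in HOL, whereas
  \<open>J\<^sub>0(0) = 1\<close>. At the poles of \<open>Gamma\<close>, HOL's \<open>x / 0 = 0\<close> agrees with the usual value of
  \<open>1 / Gamma\<close>.
\<close>
definition bessel_J :: "real \<Rightarrow> complex \<Rightarrow> complex" where
  "bessel_J \<nu> z =
     (\<Sum>n. of_real ((-1) ^ n / (fact n * Gamma (real n + \<nu> + 1))) *
          ((z / 2) ^ (2 * n) * (if \<nu> = 0 then 1 else (z / 2) powr of_real \<nu>)))"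

abbreviation bessel_J_deriv :: "nat \<Rightarrow> real \<Rightarrow> complex \<Rightarrow> complex" where
  "bessel_J_deriv k \<nu> z \<equiv> (deriv ^^ k) (bessel_J \<nu>) z"

definition bessel_N :: "real \<Rightarrow> real \<Rightarrow> real \<Rightarrow> real \<Rightarrow> complex \<Rightarrow> complex" where
  "bessel_N a b c \<nu> z =
     of_real a * z ^ 2 * bessel_J_deriv 2 \<nu> z + of_real b * z * bessel_J_deriv 1 \<nu> z
       + of_real c * bessel_J \<nu> z"

definition Q_poly :: "real \<Rightarrow> real \<Rightarrow> real \<Rightarrow> real \<Rightarrow> real" where
  "Q_poly a b c \<nu> = a * \<nu> * (\<nu> - 1) + b * \<nu> + c"

text \<open>The bound \<open>max {0, \<nu>\<^sub>0}\<close>, with \<open>\<nu>\<^sub>0\<close> the largest real root of \<open>Q\<close>; it is \<open>0\<close> if \<open>Q\<close> has no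
  real root.\<close>
definition nu_bound :: "real \<Rightarrow> real \<Rightarrow> real \<Rightarrow> real" where
  "nu_bound a b c =
     (if \<exists>x. Q_poly a b c x = 0 then max 0 (Max {x. Q_poly a b c x = 0}) else 0)"

definition norm_const :: "real \<Rightarrow> real \<Rightarrow> real \<Rightarrow> real \<Rightarrow> complex" where
  "norm_const a b c \<nu> = of_real (2 powr \<nu> * Gamma (\<nu> + 1) / Q_poly a b c \<nu>)"

text \<open>
  The normalized functions are analytic near \<open>0\<close>, but their defining formulas involve powers
  with a branch cut ending at \<open>0\<close>. Each function is therefore given by its power series at \<open>0\<close>,
  which is the unique convergent series whose sum satisfies the defining formula, read with
  principal branches, at all points of the right half-plane close to \<open>0\<close>.

  For \<open>f_fps\<close> the formula is read as \<open>f(z)\<close> to the power \<open>\<nu>\<close> being the bracket, because the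
  principal \<open>1/\<nu>\<close>-th power of the bracket need not be the required branch when \<open>\<nu>\<close> is large; the
  branch is fixed by \<open>f(0) = 0\<close> and \<open>f'(0) = 1\<close>. As \<open>f(z)/z\<close> tends to \<open>1\<close>, the principal power
  \<open>f(z) powr \<nu>\<close> is continuous there.
\<close>
definition f_fps :: "real \<Rightarrow> real \<Rightarrow> real \<Rightarrow> real \<Rightarrow> complex fps" where
  "f_fps a b c \<nu> = (THE F.
     fps_conv_radius F > 0 \<and> fps_nth F 0 = 0 \<and> fps_nth F 1 = 1 \<and>
     (\<forall>\<^sub>F z in at 0 within {z. Re z > 0}.
        eval_fps F z powr of_real \<nu> = norm_const a b c \<nu> * bessel_N a b c \<nu> z))"

definition g_fps :: "real \<Rightarrow> real \<Rightarrow> real \<Rightarrow> real \<Rightarrow> complex fps" where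
  "g_fps a b c \<nu> = (THE F.
     fps_conv_radius F > 0 \<and>
     (\<forall>\<^sub>F z in at 0 within {z. Re z > 0}.
        eval_fps F z = norm_const a b c \<nu> * z powr of_real (1 - \<nu>) * bessel_N a b c \<nu> z))"

definition h_fps :: "real \<Rightarrow> real \<Rightarrow> real \<Rightarrow> real \<Rightarrow> complex fps" where
  "h_fps a b c \<nu> = (THE F.
     fps_conv_radius F > 0 \<and>
     (\<forall>\<^sub>F z in at 0 within {z. Re z > 0}.
        eval_fps F z =
          norm_const a b c \<nu> * z powr of_real (1 - \<nu> / 2) * bessel_N a b c \<nu> (csqrt z)))"

text \<open>
  Radius of starlikeness of order \<open>\<beta>\<close> of an analytic germ \<open>F\<close> with \<open>F(0) = 0\<close>, \<open>F'(0) = 1\<close>. The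
  quotient \<open>z F'(z) / F(z)\<close> takes its limit \<open>1\<close> at the removable singularity \<open>0\<close>; elsewhere it
  has to be defined, i.e. \<open>F(z)\<close> must not vanish. The supremum is taken in the extended reals
  since the set may be unbounded.
\<close>
definition starlike_radius :: "real \<Rightarrow> complex fps \<Rightarrow> ereal" where
  "starlike_radius \<beta> F =
     Sup (ereal ` {r. 0 < r \<and> ereal r < fps_conv_radius F \<and>
       (\<forall>z \<in> ball 0 r.
          if z = 0 then 1 > \<beta>
          else eval_fps F z \<noteq> 0 \<and> Re (z * eval_fps (fps_deriv F) z / eval_fps F z) > \<beta>)})"

definition smallest_positive_root :: "(real \<Rightarrow> bool) \<Rightarrow> real \<Rightarrow> bool" where
  "smallest_positive_root E r \<longleftrightarrow> 0 < r \<and> E r \<and> (\<forall>s. 0 < s \<and> E s \<longrightarrow> r \<le> s)"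

end

theory Submission
  imports Defs "HOL-Computational_Algebra.Fundamental_Theorem_Algebra"
begin

text \<open>
  Up to the factor \<open>z\<^sup>\<nu>\<close>, the normalised function \<open>N\<^sub>\<nu>\<close> is \<open>\<Phi>(z\<^sup>2)\<close> for the entire function
  \<open>\<Phi>(w) = (\<Sum>k. Q(\<nu> + 2 k) / Q(\<nu>) (-1)\<^sup>k / (k! (\<nu> + 1)\<^sub>k 4\<^sup>k) w\<^sup>k)\<close>. Near \<open>0\<close> the three normalised functions are
  \<open>f = z \<Phi>(z\<^sup>2)\<^sup>1\<^sup>/\<^sup>\<nu>\<close>, \<open>g = z \<Phi>(z\<^sup>2)\<close> and \<open>h = z \<Phi>(z)\<close>, so in each case \<open>z F'(z) / F(z)\<close> is
  \<open>1 + \<kappa> m \<psi>(z\<^sup>m)\<close> with \<open>\<psi>(w) = w \<Phi>'(w) / \<Phi>(w)\<close>.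

  The reason for the theorem is that all zeros of \<open>\<Phi>\<close> are positive. For a polynomial
  \<open>p = (\<Prod>r\<in>#A. 1 - r w)\<close> with positive \<open>r\<close>, the function \<open>w p'/p\<close> is \<open>- (\<Sum>r\<in>#A. r w / (1 - r w))\<close>, and as
  long as no root is reached its real part on a circle about \<open>0\<close> is smallest at the positive point of
  the circle. For \<open>\<Phi>\<close> the same holds; so the disc on which \<open>Re (z F'(z) / F(z)) > \<beta>\<close> first meets an
  obstruction on the positive axis, namely at the smallest positive root of \<open>w \<Phi>'(w) + L \<Phi>(w) = 0\<close> with
  \<open>L = (1 - \<beta>) / (\<kappa> m)\<close>. Expressed by Bessel functions this is the equation of the theorem
  (\<open>pos_limit_smallest_root_log\<close>, \<open>starlike_radius_power_exp\<close>).

  Instead of a product expansion of \<open>\<Phi>\<close>, the proof uses polynomials with positive roots whose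
  coefficients converge to those of \<open>\<Phi>\<close>. Such polynomials are closed under
  \<open>p \<mapsto> \<alpha> p + \<kappa> w p' - \<delta> w p\<close> with \<open>\<alpha>, \<kappa> > 0\<close> and \<open>\<delta> \<ge> 0\<close>, up to normalisation (\<open>pos_prod_step\<close>). Starting from powers
  of a linear polynomial, this yields the approximants of the normalised Bessel function
  (\<open>pos_limit_bessel\<close>), and from there \<open>\<Phi>\<close> itself: by Bessel's differential equation, or by the
  linear factors of \<open>Q\<close> when its roots are real (\<open>pos_limit_N_coeff\<close>). Termwise inequalities for the
  approximants pass to the limit because the coefficients are dominated by those of an exponential
  function (\<open>coeff_pos_prod_bound\<close>); the locale \<open>positive_root_approximation\<close> collects the results.

  It remains to compute the derivatives of \<open>J\<^sub>\<nu>\<close> (\<open>bessel_combination_series\<close>) and to identify the power series,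
  which are characterised by their values close to \<open>0\<close> in the right half-plane
  (\<open>fps_eq_if_eval_eq_half_plane\<close>, \<open>powr_branch_unique\<close>).
\<close>

section \<open>Polynomials with positive roots\<close>

lemma sum_mset_nonneg_real: "(\<And>x. x \<in># A \<Longrightarrow> f x \<ge> 0) \<Longrightarrow> (\<Sum>x\<in>#A. f x) \<ge> (0::real)"
  by (induction A) auto

text \<open>
  The roots are the reciprocals of the members of the multiset, so every factor is \<open>1\<close> at \<open>0\<close> and
  a root that runs off to infinity corresponds to a factor that tends to \<open>1\<close>.
\<close>
definition pos_prod :: "real multiset \<Rightarrow> complex poly" where
  "pos_prod A = (\<Prod>r\<in>#A. [:1, - of_real r:])"

lemma pos_prod_empty [simp]: "pos_prod {#} = 1"
  by (simp add: pos_prod_def)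

lemma pos_prod_add [simp]: "pos_prod (add_mset r A) = [:1, - of_real r:] * pos_prod A"
  by (simp add: pos_prod_def)

lemma poly_pos_prod_eq_0_iff: "poly (pos_prod A) z = 0 \<longleftrightarrow> (\<exists>r\<in>#A. of_real r * z = 1)"
  by (induction A) (auto simp: algebra_simps)

lemma coeff_0_pos_prod [simp]: "coeff (pos_prod A) 0 = 1"
  by (induction A) (auto simp: mult_pCons_left)

lemma coeff_1_pos_prod: "coeff (pos_prod A) (Suc 0) = - of_real (sum_mset A)"
  by (induction A) (auto simp: mult_pCons_left)

lemma log_deriv_pos_prod:
  assumes "\<And>r. r \<in># A \<Longrightarrow> of_real r * z \<noteq> 1"
  shows "z * poly (pderiv (pos_prod A)) z =
    - (poly (pos_prod A) z * (\<Sum>r\<in>#A. of_real r * z / (1 - of_real r * z)))"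
  using assms
proof (induction A)
  case (add r A)
  have nz: "1 - of_real r * z \<noteq> 0" using add.prems[of r] by simp
  have IH: "z * poly (pderiv (pos_prod A)) z =
    - (poly (pos_prod A) z * (\<Sum>r\<in>#A. of_real r * z / (1 - of_real r * z)))"
    using add by auto
  have e: "(1 - of_real r * z) * (of_real r * z / (1 - of_real r * z)) = of_real r * z"
    using nz by simp
  have e2: "pderiv (pos_prod (add_mset r A)) =
      [:1, - of_real r:] * pderiv (pos_prod A) - smult (of_real r) (pos_prod A)"
    unfolding pos_prod_add pderiv_mult by (simp add: pderiv_pCons del: mult_pCons_left)
  have "z * poly (pderiv (pos_prod (add_mset r A))) z =
      (1 - of_real r * z) * (z * poly (pderiv (pos_prod A)) z)
      - of_real r * z * poly (pos_prod A) z"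
    unfolding e2 by (simp add: algebra_simps)
  also have "\<dots> = - ((1 - of_real r * z) * poly (pos_prod A) z *
      (\<Sum>r\<in>#A. of_real r * z / (1 - of_real r * z)))
      - ((1 - of_real r * z) * (of_real r * z / (1 - of_real r * z))) * poly (pos_prod A) z"
    unfolding IH e by (simp add: algebra_simps)
  also have "\<dots> = - (((1 - of_real r * z) * poly (pos_prod A) z) *
      (of_real r * z / (1 - of_real r * z) + (\<Sum>r\<in>#A. of_real r * z / (1 - of_real r * z))))"
    by (simp only: distrib_left minus_add_distrib diff_conv_add_uminus[of "- _"] mult_ac add_ac)
  also have "(1 - of_real r * z) * poly (pos_prod A) z = poly (pos_prod (add_mset r A)) z"
    by (simp add: algebra_simps)
  finally show ?case by simp
qed simp

text \<open>
  The coefficients are elementary symmetric functions \<open>e\<^sub>k\<close> of positive numbers, for which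
  \<open>k! e\<^sub>k \<le> e\<^sub>1\<^sup>k\<close>. Hence a bound on the linear coefficient alone dominates the whole power series,
  and coefficientwise convergence of such products is already locally uniform.
\<close>
lemma coeff_pos_prod_bound:
  assumes "\<And>r. r \<in># A \<Longrightarrow> r > 0"
  shows "norm (coeff (pos_prod A) k) \<le> sum_mset A ^ k / fact k"
  using assms
proof (induction A arbitrary: k)
  case empty
  show ?case by (cases k) auto
next
  case (add r A)
  have r: "r > 0" using add.prems by auto
  have S: "sum_mset A \<ge> 0"
    using sum_mset_nonneg_real[of A "\<lambda>x. x"] add.prems by (force intro: less_imp_le)
  have IH: "norm (coeff (pos_prod A) k) \<le> sum_mset A ^ k / fact k" for k
    using add by auto
  show ?case
  proof (cases k)
    case 0
    thus ?thesis using IH[of 0] by simp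
  next
    case (Suc j)
    have "norm (coeff (pos_prod (add_mset r A)) k) =
        norm (coeff (pos_prod A) (Suc j) - of_real r * coeff (pos_prod A) j)"
      by (simp add: Suc mult_pCons_left)
    also have "\<dots> \<le> norm (coeff (pos_prod A) (Suc j)) + r * norm (coeff (pos_prod A) j)"
      using norm_triangle_ineq4[of "coeff (pos_prod A) (Suc j)" "of_real r * coeff (pos_prod A) j"] r
      by (simp add: norm_mult)
    also have "\<dots> \<le> sum_mset A ^ Suc j / fact (Suc j) + r * (sum_mset A ^ j / fact j)"
      using IH[of "Suc j"] IH[of j] r by (intro add_mono mult_left_mono) (simp_all only: less_imp_le)
    also have "\<dots> = (sum_mset A ^ Suc j + real (Suc j) * r * sum_mset A ^ j) / fact (Suc j)"
      by (simp add: add_divide_distrib del: of_nat_Suc)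
    also have "\<dots> \<le> (r + sum_mset A) ^ Suc j / fact (Suc j)"
    proof (rule divide_right_mono)
      show "sum_mset A ^ Suc j + real (Suc j) * r * sum_mset A ^ j \<le> (r + sum_mset A) ^ Suc j"
      proof (induction j)
        case (Suc j)
        let ?S = "sum_mset A"
        have "?S ^ Suc (Suc j) + real (Suc (Suc j)) * r * ?S ^ Suc j
            \<le> (r + ?S) * (?S ^ Suc j + real (Suc j) * r * ?S ^ j)"
          using r S by (simp add: algebra_simps)
        also have "\<dots> \<le> (r + ?S) * (r + ?S) ^ Suc j"
          using Suc r S by (intro mult_left_mono) auto
        finally show ?case by simp
      qed auto
    qed auto
    finally show ?thesis by (simp add: Suc)
  qed
qed

text \<open>
  By the fundamental theorem of algebra; this lets a polynomial be recognised as a \<open>pos_prod\<close> by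
  locating its roots.
\<close>
lemma positive_roots_imp_pos_prod:
  assumes q0: "poly q 0 = 1"
    and roots: "\<And>z. poly q z = 0 \<Longrightarrow> z \<in> \<real> \<and> Re z > 0"
  shows "\<exists>B. (\<forall>r\<in>#B. r > 0) \<and> q = pos_prod B"
proof -
  have "q \<noteq> 0" using q0 by auto
  define M where "M = proots q"
  have M: "q = smult (lead_coeff q) (\<Prod>x\<in>#M. [:-x, 1:])"
    unfolding M_def by (rule complex_poly_decompose_multiset [symmetric])
  have root: "x \<in> \<real> \<and> Re x > 0" if "x \<in># M" for x
  proof (rule roots)
    have "poly (\<Prod>x\<in>#M. [:-x, 1:]) x = 0"
      using that by (induction M) auto
    thus "poly q x = 0" by (subst M) simp
  qed
  define B where "B = image_mset (\<lambda>x. 1 / Re x) M"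
  have "\<exists>d. (\<Prod>x\<in>#M. [:-x, 1:]) = smult d (pos_prod B)"
    using root unfolding B_def
  proof (induction M)
    case (add x M)
    then obtain d where d: "(\<Prod>x\<in>#M. [:-x, 1:]) = smult d (pos_prod (image_mset (\<lambda>x. 1 / Re x) M))"
      by auto
    have x: "x \<in> \<real>" "x \<noteq> 0" using add.prems[of x] by auto
    hence e: "[:-x, 1:] = smult (-x) [:1, - of_real (1 / Re x):]"
      by (auto elim!: Reals_cases)
    have "(\<Prod>y\<in>#add_mset x M. [:-y, 1:]) =
        smult (- x * d) (pos_prod (image_mset (\<lambda>x. 1 / Re x) (add_mset x M)))"
      unfolding image_mset_add_mset pos_prod_add prod_mset.add_mset e d
      by (simp only: mult_smult_left mult_smult_right smult_smult mult_ac)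
    thus ?case by blast
  qed (auto intro: exI[of _ 1])
  then obtain d where d: "(\<Prod>x\<in>#M. [:-x, 1:]) = smult d (pos_prod B)" by blast
  have q: "q = smult (lead_coeff q * d) (pos_prod B)"
    by (subst M) (simp add: d)
  have "poly q 0 = lead_coeff q * d"
    by (subst q) (simp add: poly_0_coeff_0)
  hence "q = pos_prod B" using q q0 by simp
  moreover have "\<forall>r\<in>#B. r > 0" using root by (auto simp: B_def)
  ultimately show ?thesis by blast
qed

text \<open>
  The map \<open>z \<mapsto> r z / (1 - r z)\<close> with \<open>r > 0\<close> preserves the upper half-plane.
\<close>
lemma Im_moebius:
  assumes "of_real r * z \<noteq> 1"
  shows "Im (of_real r * z / (1 - of_real r * z)) = r * Im z / (norm (1 - of_real r * z))\<^sup>2"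
proof -
  have nz: "1 - of_real r * z \<noteq> 0" using assms by simp
  have "of_real r * z / (1 - of_real r * z) = 1 / (1 - of_real r * z) - 1"
    using nz by (simp add: field_simps)
  thus ?thesis by (simp add: Im_divide cmod_power2)
qed

text \<open>
  The logarithmic derivative of \<open>p = pos_prod A\<close> is minus a positive combination of maps that preserve
  the upper half-plane. The new polynomial divided by \<open>p\<close>, times \<open>\<alpha>\<close>, is
  \<open>\<alpha> - \<kappa> (\<Sum>r\<in>#A. r z / (1 - r z)) - \<delta> z\<close>. Unless this is constant, its imaginary part does not
  vanish off the real axis, and on the negative axis it is at least \<open>\<alpha>\<close>. So a zero of the new polynomial is
  positive or a root of \<open>p\<close>, hence positive in any case.
\<close>
lemma pos_prod_step:
  assumes A: "\<forall>r\<in>#A. r > 0" and par: "\<alpha> > 0" "\<kappa> > 0" "\<delta> \<ge> 0"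
  shows "\<exists>B. (\<forall>r\<in>#B. r > 0) \<and>
    pos_prod B = pos_prod A + smult (of_real (\<kappa> / \<alpha>)) (pCons 0 (pderiv (pos_prod A)))
      - smult (of_real (\<delta> / \<alpha>)) (pCons 0 (pos_prod A))" (is "\<exists>B. _ \<and> _ = ?q")
proof -
  have "\<exists>B. (\<forall>r\<in>#B. r > 0) \<and> ?q = pos_prod B"
  proof (rule positive_roots_imp_pos_prod)
    show "poly ?q 0 = 1" by (simp add: poly_0_coeff_0)
  next
    fix z assume z: "poly ?q z = 0"
    let ?S = "(\<Sum>r\<in>#A. of_real r * z / (1 - of_real r * z))"
    have z0: "z \<noteq> 0" using z by (auto simp: poly_0_coeff_0)
    show "z \<in> \<real> \<and> Re z > 0"
    proof (cases "poly (pos_prod A) z = 0")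
      case True
      then obtain r where r: "r \<in># A" "of_real r * z = 1"
        by (auto simp: poly_pos_prod_eq_0_iff)
      hence "r > 0" using A by auto
      hence "z = of_real (1 / r)" using r by (simp add: field_simps)
      thus ?thesis using \<open>r > 0\<close> by simp
    next
      case False
      hence ne: "of_real r * z \<noteq> 1" if "r \<in># A" for r
        using that by (auto simp: poly_pos_prod_eq_0_iff)
      have "poly ?q z = poly (pos_prod A) z * (1 - of_real (\<kappa> / \<alpha>) * ?S - of_real (\<delta> / \<alpha>) * z)"
      proof -
        have "poly ?q z = poly (pos_prod A) z + of_real (\<kappa> / \<alpha>) * (z * poly (pderiv (pos_prod A)) z)
            - of_real (\<delta> / \<alpha>) * (z * poly (pos_prod A) z)"
          by (simp add: mult_ac)
        also have "\<dots> = poly (pos_prod A) z + of_real (\<kappa> / \<alpha>) * (- (poly (pos_prod A) z * ?S))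
            - of_real (\<delta> / \<alpha>) * (z * poly (pos_prod A) z)"
          by (simp only: log_deriv_pos_prod[OF ne])
        also have "\<dots> = poly (pos_prod A) z * (1 - of_real (\<kappa> / \<alpha>) * ?S - of_real (\<delta> / \<alpha>) * z)"
          by (simp only: ring_distribs right_diff_distrib left_diff_distrib mult_1_right mult_1_left mult_minus_right mult_ac
               diff_conv_add_uminus minus_add_distrib minus_minus)
        finally show ?thesis .
      qed
      with z False have "1 - of_real (\<kappa> / \<alpha>) * ?S - of_real (\<delta> / \<alpha>) * z = 0"
        by simp
      hence eq: "of_real \<alpha> = of_real \<kappa> * ?S + of_real \<delta> * z"
      proof -
        have "of_real \<alpha> * (of_real (\<kappa> / \<alpha>) * ?S) = of_real \<kappa> * ?S"
          "of_real \<alpha> * (of_real (\<delta> / \<alpha>) * z) = of_real \<delta> * z"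
          using par by simp_all
        thus ?thesis
          using arg_cong[OF \<open>1 - of_real (\<kappa> / \<alpha>) * ?S - of_real (\<delta> / \<alpha>) * z = 0\<close>, of "\<lambda>x. of_real \<alpha> * x"]
          unfolding right_diff_distrib by (simp only:) (simp add: algebra_simps)
      qed
      have ImS: "Im ?S = Im z * (\<Sum>r\<in>#A. r / (norm (1 - of_real r * z))\<^sup>2)"
        using ne
      proof (induction A)
        case (add r A)
        thus ?case using Im_moebius[of r z] by (simp add: algebra_simps)
      qed simp
      have pos: "(\<Sum>r\<in>#A. r / (norm (1 - of_real r * z))\<^sup>2) \<ge> 0"
        using A by (intro sum_mset_nonneg_real) (auto intro!: divide_nonneg_nonneg simp: less_imp_le)
      have pos': "(\<Sum>r\<in>#A. r / (norm (1 - of_real r * z))\<^sup>2) > 0" if "A \<noteq> {#}"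
        using that A ne
      proof (induction A)
        case (add r A)
        have "(\<Sum>r\<in>#A. r / (norm (1 - of_real r * z))\<^sup>2) \<ge> 0"
          using add.prems by (intro sum_mset_nonneg_real) (auto intro!: divide_nonneg_nonneg simp: less_imp_le)
        moreover have "r / (norm (1 - of_real r * z))\<^sup>2 > 0"
          using add.prems(2) add.prems(3)[of r] by (intro divide_pos_pos) auto
        ultimately show ?case by simp
      qed simp
      have "0 = Im z * (\<kappa> * (\<Sum>r\<in>#A. r / (norm (1 - of_real r * z))\<^sup>2) + \<delta>)"
        using arg_cong[OF eq, of Im] ImS by (simp add: algebra_simps)
      moreover have "\<kappa> * (\<Sum>r\<in>#A. r / (norm (1 - of_real r * z))\<^sup>2) + \<delta> > 0"
      proof (cases "A = {#}")
        case True
        hence "\<delta> \<noteq> 0" using eq par by auto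
        thus ?thesis using True par by simp
      next
        case False
        thus ?thesis using pos' par by (intro add_pos_nonneg mult_pos_pos) auto
      qed
      ultimately have Im0: "Im z = 0" by auto
      have "Re z > 0"
      proof (rule ccontr)
        assume "\<not> Re z > 0"
        define x where "x = - Re z"
        have x: "x \<ge> 0" using \<open>\<not> Re z > 0\<close> by (simp add: x_def)
        have zx: "z = of_real (- x)" using Im0 by (simp add: x_def complex_eq_iff)
        have "?S = of_real (\<Sum>r\<in>#A. - (r * x / (1 + r * x)))"
          unfolding zx by (induction A) auto
        hence "of_real \<alpha> = complex_of_real (\<kappa> * (\<Sum>r\<in>#A. - (r * x / (1 + r * x))) - \<delta> * x)"
          using eq by (simp add: zx)
        hence "\<alpha> = \<kappa> * (\<Sum>r\<in>#A. - (r * x / (1 + r * x))) - \<delta> * x"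
          by (simp only: of_real_eq_iff)
        moreover have "(\<Sum>r\<in>#A. - (r * x / (1 + r * x))) \<le> 0"
          using A
        proof (induction A)
          case (add r A)
          have "r * x / (1 + r * x) \<ge> 0" using add.prems x by auto
          thus ?case using add by simp
        qed simp
        hence "\<kappa> * (\<Sum>r\<in>#A. - (r * x / (1 + r * x))) \<le> 0"
          using par by (intro mult_nonneg_nonpos) auto
        moreover have "\<delta> * x \<ge> 0" using par x by auto
        ultimately show False using par by linarith
      qed
      thus ?thesis using Im0 by (auto simp: complex_is_Real_iff)
    qed
  qed
  thus ?thesis by metis
qed

section \<open>Limits of polynomials with positive roots\<close>

text \<open>
  The entire functions with these coefficients belong to the Laguerre-Polya class; their zeros are
  positive and their value at \<open>0\<close> is \<open>1\<close>. A limit may have an exponential factor \<open>exp (- \<gamma> z)\<close> with \<open>\<gamma> \<ge> 0\<close>,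
  as \<open>(1 - z / n)\<^sup>n\<close> shows. Describing the class by approximation avoids infinite products.
\<close>
definition pos_limit :: "(nat \<Rightarrow> real) \<Rightarrow> bool" where
  "pos_limit c \<longleftrightarrow> (\<exists>A. (\<forall>n. \<forall>r\<in>#A n. r > 0) \<and>
     (\<forall>k. (\<lambda>n. coeff (pos_prod (A n)) k) \<longlonglongrightarrow> of_real (c k)))"

text \<open>
  On coefficients, the operator of \<open>pos_prod_step\<close> multiplies by \<open>\<alpha> + \<kappa> k\<close> and subtracts a shift.
\<close>
lemma pos_limit_step:
  assumes c: "pos_limit c" and par: "\<alpha> > 0" "\<kappa> > 0" "\<delta> \<ge> 0"
    and c': "\<And>k. \<alpha> * c' k = (\<alpha> + \<kappa> * real k) * c k - \<delta> * (if k = 0 then 0 else c (k - 1))"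
  shows "pos_limit c'"
proof -
  obtain A where A: "\<And>n. \<forall>r\<in>#A n. r > 0"
    and lim: "\<And>k. (\<lambda>n. coeff (pos_prod (A n)) k) \<longlonglongrightarrow> of_real (c k)"
    using c by (auto simp: pos_limit_def)
  have "\<exists>B. \<forall>n. (\<forall>r\<in>#B n. r > 0) \<and>
    pos_prod (B n) = pos_prod (A n) + smult (of_real (\<kappa> / \<alpha>)) (pCons 0 (pderiv (pos_prod (A n))))
      - smult (of_real (\<delta> / \<alpha>)) (pCons 0 (pos_prod (A n)))"
    using pos_prod_step[OF A par] by (intro choice) blast
  then obtain B where B: "\<And>n. \<forall>r\<in>#B n. r > 0"
    "\<And>n. pos_prod (B n) = pos_prod (A n) + smult (of_real (\<kappa> / \<alpha>)) (pCons 0 (pderiv (pos_prod (A n))))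
      - smult (of_real (\<delta> / \<alpha>)) (pCons 0 (pos_prod (A n)))"
    by blast
  have "(\<lambda>n. coeff (pos_prod (B n)) k) \<longlonglongrightarrow> of_real (c' k)" for k
  proof -
    have e: "coeff (pos_prod (B n)) k = coeff (pos_prod (A n)) k
        + of_real (\<kappa> / \<alpha>) * (of_nat k * coeff (pos_prod (A n)) k)
        - of_real (\<delta> / \<alpha>) * (if k = 0 then 0 else coeff (pos_prod (A n)) (k - 1))" for n
      unfolding B(2) by (cases k) (auto simp: coeff_pderiv)
    have "(\<lambda>n. coeff (pos_prod (B n)) k) \<longlonglongrightarrow> of_real (c k) + of_real (\<kappa> / \<alpha>) * (of_nat k * of_real (c k))
        - of_real (\<delta> / \<alpha>) * (if k = 0 then 0 else of_real (c (k - 1)))"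
      unfolding e by (intro tendsto_intros lim tendsto_eq_intros) (auto intro!: lim)
    also have "of_real (c k) + of_real (\<kappa> / \<alpha>) * (of_nat k * of_real (c k))
        - of_real (\<delta> / \<alpha>) * (if k = 0 then 0 else of_real (c (k - 1))) =
       complex_of_real (((\<alpha> + \<kappa> * real k) * c k - \<delta> * (if k = 0 then 0 else c (k - 1))) / \<alpha>)"
      using par by (simp add: field_simps)
    also have "((\<alpha> + \<kappa> * real k) * c k - \<delta> * (if k = 0 then 0 else c (k - 1))) / \<alpha> = c' k"
      using c'[of k, symmetric] par by simp
    finally show ?thesis .
  qed
  thus ?thesis using B(1) by (auto simp: pos_limit_def)
qed

section \<open>Normalised Bessel functions as such limits\<close>

text \<open>
  Start from \<open>(1 - z / (4 n\<^sup>2))\<^sup>n\<close> and apply the operators \<open>1 + \<theta> / (\<nu> + 1 + j)\<close> for \<open>j < m\<close>, where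
  \<open>\<theta>\<close> is the Euler operator \<open>z d/dz\<close>; each keeps the roots positive. For \<open>m = n \<rightarrow> \<infinity>\<close> the
  coefficients tend to those of the normalised Bessel function.
\<close>
lemma pos_prod_bessel_approx:
  assumes \<nu>: "\<nu> > -1"
  shows "\<exists>B. (\<forall>r\<in>#B. r > 0) \<and> (\<forall>k. coeff (pos_prod B) k =
     of_real (real (n choose k) * (- 1 / (4 * real n ^ 2)) ^ k *
       (\<Prod>j<m. 1 + real k / (\<nu> + 1 + real j))))"
proof (induction m)
  case 0
  have e: "pos_prod (replicate_mset n x) = [:1, - of_real x:] ^ n" for x
    by (simp add: pos_prod_def)
  show ?case
  proof (intro exI[of _ "replicate_mset n (1 / (4 * real n ^ 2))"] conjI allI)
    show "\<forall>r\<in>#replicate_mset n (1 / (4 * real n ^ 2)). r > 0"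
      by (cases "n = 0") auto
    show "coeff (pos_prod (replicate_mset n (1 / (4 * real n ^ 2)))) k =
      of_real (real (n choose k) * (- 1 / (4 * real n ^ 2)) ^ k * (\<Prod>j<0. 1 + real k / (\<nu> + 1 + real j)))" for k
      unfolding e
      by (cases "k \<le> n")
        (subst coeff_linear_poly_power, auto simp: binomial_eq_0 intro!: coeff_eq_0
           order.strict_trans1[OF degree_power_le])
  qed
next
  case (Suc m)
  then obtain B where B: "\<forall>r\<in>#B. r > 0"
    "\<And>k. coeff (pos_prod B) k = of_real (real (n choose k) * (- 1 / (4 * real n ^ 2)) ^ k *
       (\<Prod>j<m. 1 + real k / (\<nu> + 1 + real j)))" by blast
  have s: "\<nu> + 1 + real m > 0" using \<nu> by simp
  obtain C where C: "\<forall>r\<in>#C. r > 0"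
    "pos_prod C = pos_prod B + smult (of_real (1 / (\<nu> + 1 + real m))) (pCons 0 (pderiv (pos_prod B)))
      - smult (of_real (0 / (\<nu> + 1 + real m))) (pCons 0 (pos_prod B))"
    using pos_prod_step[OF B(1) s, of 1 0] by auto
  have "coeff (pos_prod C) k = of_real (1 + real k / (\<nu> + 1 + real m)) * coeff (pos_prod B) k" for k
    unfolding C(2) by (cases k) (auto simp: coeff_pderiv algebra_simps add_divide_distrib)
  hence "coeff (pos_prod C) k = of_real (real (n choose k) * (- 1 / (4 * real n ^ 2)) ^ k *
       (\<Prod>j<Suc m. 1 + real k / (\<nu> + 1 + real j)))" for k
    by (simp add: B(2))
  thus ?case using C(1) by blast
qed

lemma choose_over_power_tendsto: "(\<lambda>n. real (n choose k) / real n ^ k) \<longlonglongrightarrow> 1 / fact k"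
proof (induction k)
  case 0
  show ?case by simp
next
  case (Suc k)
  have ev: "\<forall>\<^sub>F n in sequentially. real (n choose k) / real n ^ k * ((real n - real k) / real n) / real (Suc k)
     = real (n choose Suc k) / real n ^ Suc k"
    using eventually_gt_at_top[of "k"]
  proof eventually_elim
    case (elim n)
    have "Suc k * (n choose Suc k) = (n - k) * (n choose k)"
      by (metis binomial_absorb_comp binomial_absorption)
    hence "real (Suc k) * real (n choose Suc k) = (real n - real k) * real (n choose k)"
      using elim by (metis of_nat_diff of_nat_mult less_imp_le)
    hence "real (n choose Suc k) = (real n - real k) * real (n choose k) / real (Suc k)"
      by (simp add: field_simps)
    thus ?case by (simp add: mult_ac)
  qed
  have "(\<lambda>n. (real n - real k) / real n) \<longlonglongrightarrow> 1"
    by real_asymp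
  from tendsto_divide[OF tendsto_mult[OF Suc.IH this] tendsto_const[of "real (Suc k)"]]
  have "(\<lambda>n. real (n choose k) / real n ^ k * ((real n - real k) / real n) / real (Suc k))
     \<longlonglongrightarrow> 1 / fact k * 1 / real (Suc k)" by simp
  from Lim_transform_eventually[OF this ev] show ?case
    by (simp add: field_simps)
qed

lemma shifted_quotient_tendsto:
  fixes \<nu> :: real
  assumes \<nu>: "\<nu> > -1"
  shows "(\<lambda>n. (\<Prod>j<n. 1 + real k / (\<nu> + 1 + real j)) / real n ^ k) \<longlonglongrightarrow> 1 / pochhammer (\<nu> + 1) k"
proof (induction k)
  case 0
  show ?case by simp
next
  case (Suc k)
  have tele: "(\<Prod>j<n. 1 + real (Suc k) / (\<nu> + 1 + real j)) =
     (\<Prod>j<n. 1 + real k / (\<nu> + 1 + real j)) * ((\<nu> + 1 + real k + real n) / (\<nu> + 1 + real k))" for n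
  proof (induction n)
    case 0
    thus ?case using \<nu> by simp
  next
    case (Suc n)
    have nz: "\<nu> + 1 + real k + real n \<noteq> 0" "\<nu> + 1 + real k \<noteq> 0" "\<nu> + 1 + real n \<noteq> 0"
      using \<nu> by linarith+
    have "((\<nu> + 1 + real k + real n) / (\<nu> + 1 + real k)) * (1 + real (Suc k) / (\<nu> + 1 + real n)) =
       (1 + real k / (\<nu> + 1 + real n)) * ((\<nu> + 1 + real k + real (Suc n)) / (\<nu> + 1 + real k))"
      using nz by (simp add: field_simps)
    from arg_cong[OF this, of "\<lambda>x. (\<Prod>j<n. 1 + real k / (\<nu> + 1 + real j)) * x"]
    show ?case unfolding prod.lessThan_Suc Suc by (simp only: mult.assoc)
  qed
  have "(\<lambda>n. (\<nu> + 1 + real k + real n) / real n) \<longlonglongrightarrow> 1" by real_asymp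
  from tendsto_divide[OF tendsto_mult[OF Suc.IH this] tendsto_const[of "\<nu> + 1 + real k"]]
  have "(\<lambda>n. (\<Prod>j<n. 1 + real k / (\<nu> + 1 + real j)) / real n ^ k
      * ((\<nu> + 1 + real k + real n) / real n) / (\<nu> + 1 + real k))
     \<longlonglongrightarrow> 1 / pochhammer (\<nu> + 1) k * 1 / (\<nu> + 1 + real k)"
    using \<nu> by simp
  thus ?case unfolding tele by (simp add: pochhammer_Suc mult_ac)
qed

text \<open>
  The hypergeometric series \<open>\<^sub>0F\<^sub>1(; \<nu> + 1; - w / 4)\<close>, which at \<open>w = z\<^sup>2\<close> is
  \<open>2\<^sup>\<nu> \<Gamma>(\<nu> + 1) z\<^sup>-\<^sup>\<nu> J\<^sub>\<nu>(z)\<close>.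
\<close>
definition bessel_coeff :: "real \<Rightarrow> nat \<Rightarrow> real" where
  "bessel_coeff \<nu> k = (-1) ^ k / (fact k * pochhammer (\<nu> + 1) k * 4 ^ k)"

lemma pos_limit_bessel:
  assumes "\<nu> > -1"
  shows "pos_limit (bessel_coeff \<nu>)"
proof -
  obtain A where A: "\<And>n. \<forall>r\<in>#A n. r > 0"
    "\<And>n k. coeff (pos_prod (A n)) k =
     of_real (real (n choose k) * (- 1 / (4 * real n ^ 2)) ^ k *
       (\<Prod>j<n. 1 + real k / (\<nu> + 1 + real j)))"
  proof -
    have "\<forall>n. \<exists>B. (\<forall>r\<in>#B. r > 0) \<and> (\<forall>k. coeff (pos_prod B) k =
     of_real (real (n choose k) * (- 1 / (4 * real n ^ 2)) ^ k *
       (\<Prod>j<n. 1 + real k / (\<nu> + 1 + real j))))"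
      using pos_prod_bessel_approx[OF assms] by blast
    from choice[OF this] show ?thesis using that by blast
  qed
  have "(\<lambda>n. coeff (pos_prod (A n)) k) \<longlonglongrightarrow> of_real (bessel_coeff \<nu> k)" for k
  proof -
    have e: "real (n choose k) * (- 1 / (4 * real n ^ 2)) ^ k * (\<Prod>j<n. 1 + real k / (\<nu> + 1 + real j))
      = (-1/4) ^ k * (real (n choose k) / real n ^ k) *
        ((\<Prod>j<n. 1 + real k / (\<nu> + 1 + real j)) / real n ^ k)" for n
    proof -
      have "(- 1 / (4 * real n ^ 2)) ^ k = (-1/4) ^ k / (real n ^ k * real n ^ k)"
        by (simp add: power2_eq_square flip: power_divide power_mult_distrib)
      thus ?thesis by simp
    qed
    have "(\<lambda>n. (-1/4) ^ k * (real (n choose k) / real n ^ k) *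
        ((\<Prod>j<n. 1 + real k / (\<nu> + 1 + real j)) / real n ^ k)) \<longlonglongrightarrow>
        (-1/4) ^ k * (1 / fact k) * (1 / pochhammer (\<nu> + 1) k)"
      by (intro tendsto_mult tendsto_const choose_over_power_tendsto shifted_quotient_tendsto assms)
    also have "(-1/4) ^ k * (1 / fact k) * (1 / pochhammer (\<nu> + 1) k) = bessel_coeff \<nu> k"
    proof -
      have "(-1/4) ^ k = (-1) ^ k / (4::real) ^ k" by (simp only: power_divide)
      thus ?thesis by (simp add: bessel_coeff_def)
    qed
    finally show ?thesis unfolding A(2) e by (rule tendsto_of_real)
  qed
  thus ?thesis unfolding pos_limit_def using A(1) by (intro exI[of _ A] conjI allI)
qed

section \<open>Entire functions approximated by polynomials with positive roots\<close>

definition real_fps :: "(nat \<Rightarrow> real) \<Rightarrow> 'a :: {real_normed_field, banach} fps" where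
  "real_fps c = Abs_fps (\<lambda>k. of_real (c k))"

lemma real_fps_nth [simp]: "fps_nth (real_fps c) k = of_real (c k)"
  by (simp add: real_fps_def)

lemma fps_deriv_real_fps: "fps_deriv (real_fps c) = real_fps (\<lambda>k. real (k + 1) * c (k + 1))"
  by (rule fps_ext) (simp add: real_fps_def)

lemma summable_exponential_bound: "summable (\<lambda>k. B ^ k / fact k * (x::real) ^ k)"
  using summable_exp[of "B * x"] by (simp add: field_simps power_mult_distrib)

lemma fps_conv_radius_real_fps:
  assumes "\<And>k. \<bar>c k\<bar> \<le> B ^ k / fact k"
  shows "fps_conv_radius (real_fps c :: 'a :: {real_normed_field, banach} fps) = \<infinity>"
  unfolding fps_conv_radius_def real_fps_nth
proof (rule conv_radius_inftyI'')
  fix z :: 'a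
  show "summable (\<lambda>k. of_real (c k) * z ^ k)"
  proof (rule summable_comparison_test'[OF summable_exponential_bound[of B "norm z"], where N = 0])
    show "norm (of_real (c k) * z ^ k) \<le> B ^ k / fact k * norm z ^ k" for k
      using mult_right_mono[OF assms[of k], of "norm z ^ k"] by (simp add: norm_mult norm_power)
  qed
qed

lemma eval_real_fps_of_real:
  assumes "fps_conv_radius (real_fps c :: real fps) = \<infinity>"
  shows "eval_fps (real_fps c) (complex_of_real x) = of_real (eval_fps (real_fps c) x)"
proof -
  have "summable (\<lambda>k. c k * x ^ k)"
    using summable_fps[of x "real_fps c"] assms by simp
  from suminf_of_real[OF this, where 'a = complex] show ?thesis
    by (simp add: eval_fps_def)
qed

lemma poly_sums: "(\<lambda>k. coeff p k * z ^ k) sums poly (p :: complex poly) z"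
proof -
  have "(\<lambda>k. coeff p k * z ^ k) sums (\<Sum>k\<le>degree p. coeff p k * z ^ k)"
    by (rule sums_finite) (auto simp: coeff_eq_0)
  thus ?thesis by (simp add: poly_altdef)
qed

text \<open>
  Replacing \<open>z\<close> by \<open>\<bar>z\<bar>\<close> moves the point closer to each positive root, which enlarges no factor in modulus.
\<close>
lemma norm_poly_pos_prod_ge:
  assumes "\<forall>r\<in>#A. r > 0"
  shows "norm (poly (pos_prod A) (of_real (norm z))) \<le> norm (poly (pos_prod A) z)"
  using assms
proof (induction A)
  case (add r A)
  have r: "r > 0" using add.prems by auto
  have e: "poly (pos_prod (add_mset r A)) w = (1 - of_real r * w) * poly (pos_prod A) w" for w
    by (simp add: algebra_simps)
  have "norm (1 - of_real r * complex_of_real (norm z)) = \<bar>norm (1::complex) - norm (of_real r * z)\<bar>"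
  proof -
    have "1 - of_real r * complex_of_real (norm z) = of_real (1 - r * norm z)" by simp
    thus ?thesis using r by (simp only: norm_of_real norm_mult norm_one abs_of_pos)
  qed
  also have "\<dots> \<le> norm (1 - of_real r * z)"
    by (rule norm_triangle_ineq3)
  finally show ?case unfolding e norm_mult
    using add by (intro mult_mono) auto
qed auto

lemma Re_moebius_le:
  assumes r: "r > 0" "r * norm z < 1"
  shows "Re (of_real r * z / (1 - of_real r * z)) \<le> r * norm z / (1 - r * norm z)"
proof -
  have n1: "norm (of_real r * z) = r * norm z" using r by (simp add: norm_mult)
  have d: "1 - r * norm z \<le> norm (1 - of_real r * z)"
    using norm_triangle_ineq2[of 1 "of_real r * z"] n1 by simp
  have "Re (of_real r * z / (1 - of_real r * z)) \<le> norm (of_real r * z / (1 - of_real r * z))"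
    by (rule complex_Re_le_cmod)
  also have "\<dots> = r * norm z / norm (1 - of_real r * z)" by (simp add: norm_divide n1)
  also have "\<dots> \<le> r * norm z / (1 - r * norm z)"
    using r d by (intro divide_left_mono mult_pos_pos) auto
  finally show ?thesis .
qed

locale positive_root_approximation =
  fixes A :: "nat \<Rightarrow> real multiset" and c :: "nat \<Rightarrow> real"
  assumes pos: "\<And>n. \<forall>r\<in>#A n. r > 0"
    and lim: "\<And>k. (\<lambda>n. coeff (pos_prod (A n)) k) \<longlonglongrightarrow> of_real (c k)"
begin

lemma coeff_bounds:
  obtains B where "B > 0" "\<And>n k. norm (coeff (pos_prod (A n)) k) \<le> B ^ k / fact k"
    "\<And>k. \<bar>c k\<bar> \<le> B ^ k / fact k"
proof -
  have "Bseq (\<lambda>n. coeff (pos_prod (A n)) 1)"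
    using lim[of 1] by (intro convergent_imp_Bseq) (auto simp: convergent_def)
  then obtain B where B: "B > 0" "\<And>n. norm (coeff (pos_prod (A n)) 1) \<le> B"
    by (auto simp: Bseq_def)
  have 1: "norm (coeff (pos_prod (A n)) k) \<le> B ^ k / fact k" for n k
  proof -
    have S: "sum_mset (A n) \<ge> 0"
      using sum_mset_nonneg_real[of "A n" "\<lambda>x. x"] pos[of n] by (auto intro: less_imp_le)
    have "sum_mset (A n) \<le> B"
      using B(2)[of n] by (simp add: coeff_1_pos_prod)
    hence "sum_mset (A n) ^ k \<le> B ^ k" using S by (intro power_mono)
    moreover have "norm (coeff (pos_prod (A n)) k) \<le> sum_mset (A n) ^ k / fact k"
      using pos[of n] by (intro coeff_pos_prod_bound) auto
    ultimately show ?thesis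
      using divide_right_mono[of "sum_mset (A n) ^ k" "B ^ k" "fact k"] by fastforce
  qed
  have "\<bar>c k\<bar> \<le> B ^ k / fact k" for k
    using LIMSEQ_le_const2[OF tendsto_norm[OF lim[of k]], of "B ^ k / fact k"] 1 by auto
  with 1 B(1) show ?thesis using that by blast
qed

lemma conv_radius: "fps_conv_radius (real_fps c :: 'a :: {real_normed_field, banach} fps) = \<infinity>"
  using coeff_bounds fps_conv_radius_real_fps[of c] by metis

lemma conv_radius_deriv: "fps_conv_radius (fps_deriv (real_fps c) :: real fps) = \<infinity>"
  using fps_conv_radius_deriv[of "real_fps c :: real fps"] conv_radius[where 'a = real] by simp

text \<open>
  Tannery's theorem for \<open>\<Sum>k. \<bar>a\<^sub>n\<^sub>k - c\<^sub>k\<bar> R\<^sup>k\<close>, with \<open>a\<^sub>n\<^sub>k\<close> the coefficients of the approximants.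
\<close>
lemma uniform_approx:
  assumes "R \<ge> 0" "\<epsilon> > 0"
  shows "\<forall>\<^sub>F n in sequentially. \<forall>z. norm z \<le> R \<longrightarrow>
    norm (poly (pos_prod (A n)) z - eval_fps (real_fps c) z) < \<epsilon>"
proof -
  obtain B where B: "B > 0" "\<And>n k. norm (coeff (pos_prod (A n)) k) \<le> B ^ k / fact k"
    "\<And>k. \<bar>c k\<bar> \<le> B ^ k / fact k"
    by (rule coeff_bounds) blast
  define a where "a = (\<lambda>k n. norm (coeff (pos_prod (A n)) k - of_real (c k)) * R ^ k)"
  have bd: "norm (a k n) \<le> 2 * (B ^ k / fact k * R ^ k)" for k n
  proof -
    have "norm (coeff (pos_prod (A n)) k - of_real (c k)) \<le> B ^ k / fact k + B ^ k / fact k"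
      by (rule order.trans[OF norm_triangle_ineq4 add_mono]) (use B in auto)
    from mult_right_mono[OF this, of "R ^ k"] show ?thesis
      using assms by (simp add: a_def)
  qed
  have sM: "summable (\<lambda>k. 2 * (B ^ k / fact k * R ^ k))"
    by (intro summable_mult summable_exponential_bound)
  have "(\<lambda>n. suminf (\<lambda>k. a k n)) \<longlonglongrightarrow> suminf (\<lambda>k. 0)"
  proof (rule tannerys_theorem[THEN conjunct2, THEN conjunct2])
    show "(\<lambda>n. a k n) \<longlonglongrightarrow> 0" for k
      unfolding a_def using tendsto_mult[OF tendsto_norm[OF LIM_zero[OF lim[of k]]] tendsto_const[of "R ^ k"]]
      by simp
    show "\<forall>\<^sub>F (k, n) in sequentially \<times>\<^sub>F sequentially. norm (a k n) \<le> 2 * (B ^ k / fact k * R ^ k)"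
      using bd by (intro always_eventually) auto
  qed (use sM in auto)
  hence "\<forall>\<^sub>F n in sequentially. suminf (\<lambda>k. a k n) < \<epsilon>"
    using assms by (intro order_tendstoD) auto
  thus ?thesis
  proof eventually_elim
    case (elim n)
    show ?case
    proof (intro allI impI)
      fix z :: complex assume z: "norm z \<le> R"
      have sa: "summable (\<lambda>k. a k n)"
        by (rule summable_comparison_test'[OF sM, where N = 0]) (use bd in auto)
      have "(\<lambda>k. of_real (c k) * z ^ k) sums eval_fps (real_fps c) z"
        using summable_fps[of z "real_fps c"] conv_radius[where 'a = complex]
        by (simp add: eval_fps_def summable_sums)
      from sums_diff[OF poly_sums[of "pos_prod (A n)" z] this]
      have s: "(\<lambda>k. (coeff (pos_prod (A n)) k - of_real (c k)) * z ^ k) sums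
        (poly (pos_prod (A n)) z - eval_fps (real_fps c) z)"
        by (simp add: algebra_simps)
      have le: "norm ((coeff (pos_prod (A n)) k - of_real (c k)) * z ^ k) \<le> a k n" for k
        unfolding a_def norm_mult norm_power using z by (intro mult_left_mono power_mono) auto
      have "norm (\<Sum>k. (coeff (pos_prod (A n)) k - of_real (c k)) * z ^ k) \<le> (\<Sum>k. a k n)"
        by (rule norm_suminf_le[OF le sa])
      thus "norm (poly (pos_prod (A n)) z - eval_fps (real_fps c) z) < \<epsilon>"
        using elim s by (simp add: sums_iff)
    qed
  qed
qed

lemma poly_tendsto: "(\<lambda>n. poly (pos_prod (A n)) z) \<longlonglongrightarrow> eval_fps (real_fps c) z"
proof (rule tendstoI)
  fix e :: real assume "e > 0"
  from uniform_approx[of "norm z" e] this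
  show "\<forall>\<^sub>F n in sequentially. dist (poly (pos_prod (A n)) z) (eval_fps (real_fps c) z) < e"
    by (auto simp: dist_norm elim!: eventually_mono)
qed

lemma poly_deriv_tendsto:
  "(\<lambda>n. poly (pderiv (pos_prod (A n))) z) \<longlonglongrightarrow> eval_fps (fps_deriv (real_fps c)) z"
proof -
  obtain B where B: "B > 0" "\<And>n k. norm (coeff (pos_prod (A n)) k) \<le> B ^ k / fact k"
    by (rule coeff_bounds) blast
  define a where "a = (\<lambda>k n. coeff (pderiv (pos_prod (A n))) k * z ^ k)"
  have "(\<lambda>n. suminf (\<lambda>k. a k n)) \<longlonglongrightarrow> suminf (\<lambda>k. fps_nth (fps_deriv (real_fps c)) k * z ^ k)"
  proof (rule tannerys_theorem[THEN conjunct2, THEN conjunct2])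
    show "(\<lambda>n. a k n) \<longlonglongrightarrow> fps_nth (fps_deriv (real_fps c)) k * z ^ k" for k
    proof -
      have "(\<lambda>n. of_nat (Suc k) * coeff (pos_prod (A n)) (Suc k) * z ^ k) \<longlonglongrightarrow>
        of_nat (Suc k) * of_real (c (Suc k)) * z ^ k"
        by (intro tendsto_intros lim)
      thus ?thesis by (simp add: a_def coeff_pderiv)
    qed
    have "norm (a k n) \<le> B * (B ^ k / fact k * norm z ^ k)" for k n
    proof -
      have "norm (a k n) = real (Suc k) * norm (coeff (pos_prod (A n)) (Suc k)) * norm z ^ k"
        by (simp add: a_def coeff_pderiv norm_mult norm_power del: of_nat_Suc)
      also have "\<dots> \<le> real (Suc k) * (B ^ Suc k / fact (Suc k)) * norm z ^ k"
        using B(2)[of n "Suc k"] by (intro mult_right_mono mult_left_mono) (auto simp del: fact_Suc power_Suc)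
      finally show ?thesis by simp
    qed
    thus "\<forall>\<^sub>F (k, n) in sequentially \<times>\<^sub>F sequentially. norm (a k n) \<le> B * (B ^ k / fact k * norm z ^ k)"
      by (intro always_eventually) auto
    show "summable (\<lambda>k. B * (B ^ k / fact k * norm z ^ k))"
      by (intro summable_mult summable_exponential_bound)
  qed auto
  thus ?thesis using sums_unique[OF poly_sums[of "pderiv (pos_prod (A _))" z]]
    by (simp add: a_def eval_fps_def)
qed

text \<open>
  This replaces the theorem of Hurwitz: the limit has no zero on the circle of radius \<open>x\<close> unless
  \<open>x\<close> is itself a zero.
\<close>
lemma norm_eval_ge:
  fixes z :: complex
  shows "norm (eval_fps (real_fps c) (complex_of_real (norm z))) \<le> norm (eval_fps (real_fps c) z)"
  by (rule LIMSEQ_le[OF tendsto_norm[OF poly_tendsto] tendsto_norm[OF poly_tendsto]])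
     (use norm_poly_pos_prod_ge[OF pos] in blast)

text \<open>
  A root of an approximant in \<open>(0, R]\<close> would make the limit small there by uniform convergence, against
  its positive minimum modulus on the compact interval.
\<close>
lemma eventually_roots_outside:
  assumes "R \<ge> 0" and nz: "\<And>x. 0 \<le> x \<Longrightarrow> x \<le> R \<Longrightarrow> eval_fps (real_fps c) (complex_of_real x) \<noteq> 0"
  shows "\<forall>\<^sub>F n in sequentially. \<forall>r\<in>#A n. r * R < 1"
proof -
  have "continuous_on {0..R} (\<lambda>x. norm (eval_fps (real_fps c) (complex_of_real x)))"
    using conv_radius[where 'a = complex] by (intro continuous_intros) auto
  then obtain x0 where x0: "x0 \<in> {0..R}" 
    "\<And>x. x \<in> {0..R} \<Longrightarrow> norm (eval_fps (real_fps c) (complex_of_real x0)) \<le> norm (eval_fps (real_fps c) (complex_of_real x))"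
    using continuous_attains_inf[of "{0..R}" "\<lambda>x. norm (eval_fps (real_fps c) (complex_of_real x))"]
      assms(1) by (auto simp del: atLeastAtMost_iff)
  have "norm (eval_fps (real_fps c) (complex_of_real x0)) > 0" using nz[of x0] x0(1) by simp
  from uniform_approx[OF assms(1) this] show ?thesis
  proof eventually_elim
    case (elim n)
    show ?case
    proof (rule ballI, rule ccontr)
      fix r assume r: "r \<in># A n" "\<not> r * R < 1"
      have r0: "r > 0" using pos r by auto
      have x: "1 / r \<in> {0..R}" using r0 r(2) by (auto simp: field_simps)
      have "poly (pos_prod (A n)) (complex_of_real (1 / r)) = 0"
        using r r0 by (auto simp: poly_pos_prod_eq_0_iff intro!: bexI[of _ r])
      moreover have "norm (complex_of_real (1 / r)) \<le> R" using x by (simp add: norm_divide)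
      ultimately have "norm (eval_fps (real_fps c) (complex_of_real (1 / r))) <
          norm (eval_fps (real_fps c) (complex_of_real x0))"
        using elim by (metis diff_0 norm_minus_cancel)
      thus False using x0(2)[OF x] by simp
    qed
  qed
qed

lemma log_deriv_tendsto:
  fixes z :: complex
  assumes "eval_fps (real_fps c) z \<noteq> 0"
    "\<forall>\<^sub>F n in sequentially. \<forall>r\<in>#A n. of_real r * z \<noteq> 1"
  shows "(\<lambda>n. - (\<Sum>r\<in>#A n. of_real r * z / (1 - of_real r * z))) \<longlonglongrightarrow>
     z * eval_fps (fps_deriv (real_fps c)) z / eval_fps (real_fps c) z"
proof (rule Lim_transform_eventually)
  show "(\<lambda>n. z * poly (pderiv (pos_prod (A n))) z / poly (pos_prod (A n)) z) \<longlonglongrightarrow>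
     z * eval_fps (fps_deriv (real_fps c)) z / eval_fps (real_fps c) z"
    by (intro tendsto_divide tendsto_mult tendsto_const poly_tendsto poly_deriv_tendsto assms)
  show "\<forall>\<^sub>F n in sequentially. z * poly (pderiv (pos_prod (A n))) z / poly (pos_prod (A n)) z =
     - (\<Sum>r\<in>#A n. of_real r * z / (1 - of_real r * z))"
    using assms(2)
  proof eventually_elim
    case (elim n)
    have "poly (pos_prod (A n)) z \<noteq> 0" using elim by (auto simp: poly_pos_prod_eq_0_iff)
    thus ?case using log_deriv_pos_prod[of "A n" z] elim by (simp add: field_simps)
  qed
qed

text \<open>
  Both sides are limits of \<open>- (\<Sum>r\<in>#A n. r z / (1 - r z))\<close>, for which the inequality holds
  termwise by \<open>Re_moebius_le\<close>. This is the step that reduces starlikeness on a disc to the positive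
  radius.
\<close>
lemma Re_log_deriv_ge:
  fixes z :: complex
  assumes nz: "\<And>x. 0 \<le> x \<Longrightarrow> x \<le> norm z \<Longrightarrow> eval_fps (real_fps c) (complex_of_real x) \<noteq> 0"
  defines "x \<equiv> complex_of_real (norm z)"
  shows "Re (x * eval_fps (fps_deriv (real_fps c)) x / eval_fps (real_fps c) x)
    \<le> Re (z * eval_fps (fps_deriv (real_fps c)) z / eval_fps (real_fps c) z)"
proof -
  have ev: "\<forall>\<^sub>F n in sequentially. \<forall>r\<in>#A n. r * norm z < 1"
    by (rule eventually_roots_outside) (use nz in auto)
  have ne: "of_real r * w \<noteq> 1" if "norm w = norm z" "r * norm z < 1" "r > 0" for r and w :: complex
  proof
    assume "of_real r * w = 1"
    hence "norm (of_real r * w) = 1" by simp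
    thus False using that by (simp add: norm_mult)
  qed
  have ev1: "\<forall>\<^sub>F n in sequentially. \<forall>r\<in>#A n. of_real r * w \<noteq> 1" if "norm w = norm z" for w :: complex
    using ev by eventually_elim (use pos ne that in blast)
  have nx: "norm x = norm z" by (simp add: x_def)
  have nzx: "eval_fps (real_fps c) x \<noteq> 0" using nz[of "norm z"] by (simp add: x_def)
  have nzz: "eval_fps (real_fps c) z \<noteq> 0" using norm_eval_ge[of z] nzx by (auto simp: x_def)
  show ?thesis
  proof (rule tendsto_le[OF sequentially_bot tendsto_Re[OF log_deriv_tendsto[OF nzz ev1]]
        tendsto_Re[OF log_deriv_tendsto[OF nzx ev1[OF nx]]]])
    show "\<forall>\<^sub>F n in sequentially. Re (- (\<Sum>r\<in>#A n. of_real r * x / (1 - of_real r * x)))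
       \<le> Re (- (\<Sum>r\<in>#A n. of_real r * z / (1 - of_real r * z)))"
      using ev
    proof eventually_elim
      case (elim n)
      have "Re (\<Sum>r\<in>#M. of_real r * z / (1 - of_real r * z)) \<le> Re (\<Sum>r\<in>#M. of_real r * x / (1 - of_real r * x))"
        if "\<And>r. r \<in># M \<Longrightarrow> r > 0 \<and> r * norm z < 1" for M
        using that
      proof (induction M)
        case (add r M)
        have "of_real r * x / (1 - of_real r * x) = complex_of_real (r * norm z / (1 - r * norm z))"
          by (simp add: x_def)
        thus ?case using add Re_moebius_le[of r z] by force
      qed simp
      thus ?case using elim pos by simp
    qed
  qed auto
qed

text \<open>
  From \<open>r x / (1 - r x) \<ge> r x\<close>, and the fact that the sum of the \<open>r\<close> is minus the linear coefficient.
  If that coefficient is negative, the logarithmic derivative is forced to \<open>- \<infinity>\<close> even when there is no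
  positive zero.
\<close>
lemma log_deriv_le_linear:
  assumes "x \<ge> 0" and nz: "\<And>y. 0 \<le> y \<Longrightarrow> y \<le> x \<Longrightarrow> eval_fps (real_fps c) (complex_of_real y) \<noteq> 0"
  shows "Re (of_real x * eval_fps (fps_deriv (real_fps c)) (of_real x) / eval_fps (real_fps c) (of_real x))
    \<le> c 1 * x"
proof (rule tendsto_le[OF sequentially_bot])
  have ev: "\<forall>\<^sub>F n in sequentially. \<forall>r\<in>#A n. r * x < 1"
    by (rule eventually_roots_outside) (use nz assms in auto)
  show "(\<lambda>n. Re (- (\<Sum>r\<in>#A n. of_real r * of_real x / (1 - of_real r * of_real x)))) \<longlonglongrightarrow>
    Re (of_real x * eval_fps (fps_deriv (real_fps c)) (of_real x) / eval_fps (real_fps c) (of_real x))"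
  proof (intro tendsto_Re log_deriv_tendsto)
    show "eval_fps (real_fps c) (complex_of_real x) \<noteq> 0" using nz[of x] assms by auto
    show "\<forall>\<^sub>F n in sequentially. \<forall>r\<in>#A n. complex_of_real r * complex_of_real x \<noteq> 1"
      using ev by eventually_elim (simp flip: of_real_mult, force)
  qed
  show "(\<lambda>n. Re (coeff (pos_prod (A n)) 1) * x) \<longlonglongrightarrow> c 1 * x"
    using tendsto_Re[OF lim[of 1]] by (intro tendsto_mult tendsto_const) simp
  show "\<forall>\<^sub>F n in sequentially. Re (- (\<Sum>r\<in>#A n. of_real r * of_real x / (1 - of_real r * of_real x)))
     \<le> Re (coeff (pos_prod (A n)) 1) * x"
    using ev
  proof eventually_elim
    case (elim n)
    have "sum_mset M * x \<le> Re (\<Sum>r\<in>#M. of_real r * of_real x / (1 - of_real r * of_real x))"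
      if "\<And>r. r \<in># M \<Longrightarrow> r > 0 \<and> r * x < 1" for M
      using that
    proof (induction M)
      case (add r M)
      have "of_real r * of_real x / (1 - of_real r * of_real x) = complex_of_real (r * x / (1 - r * x))"
        by simp
      moreover have "r * x \<le> r * x / (1 - r * x)"
        using add.prems[of r] assms(1) by (simp add: field_simps)
      ultimately show ?case using add by (simp add: algebra_simps)
    qed simp
    from this[of "A n"] show ?case using elim pos by (simp add: coeff_1_pos_prod)
  qed
qed

end

section \<open>The smallest root and a logarithm\<close>

text \<open>
  Let \<open>G(x) = x \<Phi>'(x) + L \<Phi>(x)\<close>, so that \<open>G(0) = L > 0\<close>. The derivative of \<open>x\<^sup>L \<Phi>(x)\<close> is
  \<open>x\<^sup>L\<^sup>-\<^sup>1 G(x)\<close>; hence \<open>\<Phi>\<close> stays positive as long as \<open>G \<ge> 0\<close>. If \<open>G\<close> were positive throughout, then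
  \<open>\<Phi> > 0\<close> on the whole half-line and \<open>x \<Phi>'/\<Phi> > - L\<close>, contradicting the linear upper bound.
  So \<open>G\<close> has a smallest positive zero \<open>\<rho>\<close>, and \<open>\<Phi>\<close> is positive on \<open>[0, \<rho>]\<close> and a little beyond. By
  \<open>norm_eval_ge\<close> it is zero-free on a disc of radius \<open>\<rho>' > \<rho>\<close>, where it has a logarithm. The extra room
  beyond \<open>\<rho>\<close> makes the boundary point \<open>\<rho>\<close> an interior point of the domain of the logarithm.
\<close>
theorem pos_limit_smallest_root_log:
  fixes c :: "nat \<Rightarrow> real" and L :: real
  defines "\<Phi> \<equiv> eval_fps (real_fps c :: complex fps)"
    and "\<Phi>' \<equiv> eval_fps (fps_deriv (real_fps c) :: complex fps)"
  assumes c: "pos_limit c" and c0: "c 0 = 1" and c1: "c 1 < 0" and L: "L > 0"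
  obtains \<rho> \<rho>' l where "0 < \<rho>" "\<rho> < \<rho>'" "l holomorphic_on ball 0 \<rho>'" "l 0 = 0"
    "\<And>w. w \<in> ball 0 \<rho>' \<Longrightarrow> \<Phi> w = exp (l w)"
    "\<And>w. norm w < \<rho> \<Longrightarrow> Re (w * deriv l w) > - L"
    "of_real \<rho> * deriv l (of_real \<rho>) = - of_real L"
    "of_real \<rho> * \<Phi>' (of_real \<rho>) + of_real L * \<Phi> (of_real \<rho>) = 0"
    "\<And>s. s > 0 \<Longrightarrow> of_real s * \<Phi>' (of_real s) + of_real L * \<Phi> (of_real s) = 0 \<Longrightarrow> \<rho> \<le> s"
proof -
  obtain A where A: "\<And>n. \<forall>r\<in>#A n. r > 0"
    "\<And>k. (\<lambda>n. coeff (pos_prod (A n)) k) \<longlonglongrightarrow> of_real (c k)"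
    using c by (auto simp: pos_limit_def)
  interpret positive_root_approximation A c
    by unfold_locales (use A in auto)
  define \<phi> where "\<phi> = eval_fps (real_fps c :: real fps)"
  define \<phi>' where "\<phi>' = eval_fps (fps_deriv (real_fps c) :: real fps)"
  define G where "G = (\<lambda>x. x * \<phi>' x + L * \<phi> x)"
  have \<Phi>_real: "\<Phi> (of_real x) = of_real (\<phi> x)" for x
    unfolding \<Phi>_def \<phi>_def by (rule eval_real_fps_of_real) (rule conv_radius)
  have \<Phi>'_real: "\<Phi>' (of_real x) = of_real (\<phi>' x)" for x
    unfolding \<Phi>'_def \<phi>'_def fps_deriv_real_fps
    by (rule eval_real_fps_of_real) (use conv_radius_deriv in \<open>simp add: fps_deriv_real_fps\<close>)
  have G_real: "of_real x * \<Phi>' (of_real x) + of_real L * \<Phi> (of_real x) = of_real (G x)" for x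
    by (simp add: \<Phi>_real \<Phi>'_real G_def)
  have D: "(\<phi> has_real_derivative \<phi>' x) (at x)" for x
    unfolding \<phi>_def \<phi>'_def by (rule has_field_derivative_eval_fps) (simp add: conv_radius)
  have cont_\<phi>: "continuous_on S \<phi>" for S
    using D by (meson DERIV_isCont continuous_at_imp_continuous_on)
  have cont_\<phi>': "continuous_on S \<phi>'" for S
    unfolding \<phi>'_def
    by (intro continuous_at_imp_continuous_on ballI DERIV_isCont[OF has_field_derivative_eval_fps])
      (simp add: conv_radius_deriv)
  have cont_G: "continuous_on S G" for S
    unfolding G_def by (intro continuous_intros cont_\<phi> cont_\<phi>')
  have \<phi>0: "\<phi> 0 = 1" by (simp add: \<phi>_def eval_fps_at_0 c0)
  have G0: "G 0 = L" by (simp add: G_def \<phi>0)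

  have \<phi>_pos: "\<phi> x > 0" if G: "\<And>y. 0 < y \<Longrightarrow> y \<le> x \<Longrightarrow> G y \<ge> 0" and x: "x > 0" for x
  proof -
    have "\<forall>\<^sub>F y in at_right 0. \<phi> y > 0"
    proof -
      have "(\<phi> \<longlongrightarrow> \<phi> 0) (at_right 0)"
        using D[of 0] DERIV_isCont isCont_def tendsto_within_subset by (metis subset_UNIV)
      thus ?thesis by (rule order_tendstoD) (simp add: \<phi>0)
    qed
    hence "\<forall>\<^sub>F y in at_right 0. \<phi> y > 0 \<and> y < x \<and> y > 0"
      using eventually_at_right_real[OF x] by eventually_elim auto
    then obtain y where y: "\<phi> y > 0" "0 < y" "y < x"
      by (metis (no_types, lifting) eventually_happens trivial_limit_at_right_real)
    have "y powr L * \<phi> y \<le> x powr L * \<phi> x"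
    proof (rule DERIV_nonneg_imp_nondecreasing[where f = "\<lambda>t. t powr L * \<phi> t"])
      show "y \<le> x" using y by simp
      fix t assume t: "y \<le> t" "t \<le> x"
      hence t0: "t > 0" using y by simp
      have "((\<lambda>t. t powr L * \<phi> t) has_real_derivative
          (L * t powr (L - 1)) * \<phi> t + \<phi>' t * t powr L) (at t)"
        by (intro DERIV_mult D has_real_derivative_powr t0)
      moreover have "(L * t powr (L - 1)) * \<phi> t + \<phi>' t * t powr L = t powr (L - 1) * G t"
        using t0 by (simp add: G_def powr_diff field_simps)
      moreover have "t powr (L - 1) * G t \<ge> 0" using G[of t] t t0 by simp
      ultimately show "\<exists>d. ((\<lambda>t. t powr L * \<phi> t) has_real_derivative d) (at t) \<and> 0 \<le> d"
        by metis
    qed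
    moreover have "y powr L * \<phi> y > 0" using y by simp
    ultimately have "x powr L * \<phi> x > 0" by linarith
    thus ?thesis using x by (simp add: zero_less_mult_iff)
  qed

  have "\<exists>x>0. G x \<le> 0"
  proof (rule ccontr)
    assume "\<not> (\<exists>x>0. G x \<le> 0)"
    hence Gp: "G x > 0" if "x > 0" for x using that by force
    have pp: "\<phi> x > 0" if "x \<ge> 0" for x
      using \<phi>_pos[of x] Gp \<phi>0 that by (cases "x = 0") (auto intro: less_imp_le)
    \<comment> \<open>at this point the linear bound \<open>c 1 * x\<close> equals \<open>- L\<close>\<close>
    define x where "x = - L / c 1"
    have x: "x > 0" using c1 L by (simp add: x_def field_simps)
    have "Re (of_real x * \<Phi>' (of_real x) / \<Phi> (of_real x)) \<le> c 1 * x"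
      unfolding \<Phi>_def \<Phi>'_def
    proof (rule log_deriv_le_linear)
      show "x \<ge> 0" using x by simp
      show "eval_fps (real_fps c) (complex_of_real y) \<noteq> 0" if "0 \<le> y" for y
        using pp[OF that] \<Phi>_real[of y] by (simp add: \<Phi>_def)
    qed
    also have "of_real x * \<Phi>' (of_real x) / \<Phi> (of_real x) = of_real (x * \<phi>' x / \<phi> x)"
      by (simp add: \<Phi>_real \<Phi>'_real)
    also have "c 1 * x = - L" using c1 by (simp add: x_def)
    finally have "x * \<phi>' x / \<phi> x \<le> - L" by simp
    hence "G x \<le> 0" using pp[of x] x by (simp add: G_def field_simps)
    thus False using Gp[OF x] by simp
  qed
  then obtain X where X: "X > 0" "G X \<le> 0" by blast
  define Z where "Z = {x \<in> {0..X}. G x = 0}"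
  have "\<exists>x\<ge>0. x \<le> X \<and> G x = 0"
    using X L G0 cont_G by (intro IVT2') auto
  hence "Z \<noteq> {}" by (auto simp: Z_def)
  moreover have "compact Z"
  proof -
    have "closed Z" unfolding Z_def
      using continuous_closed_preimage_constant[OF cont_G[of "{0..X}"], of 0] by simp
    thus ?thesis using compact_Int_closed[of "{0..X}" Z] by (simp add: Z_def Int_def conj_ac cong: conj_cong)
  qed
  ultimately obtain \<rho> where \<rho>: "\<rho> \<in> Z" "\<And>x. x \<in> Z \<Longrightarrow> \<rho> \<le> x"
    using compact_attains_inf by metis
  have \<rho>0: "\<rho> > 0" using \<rho>(1) G0 L by (cases "\<rho> = 0") (auto simp: Z_def)
  have G\<rho>: "G \<rho> = 0" and \<rho>X: "\<rho> \<le> X" using \<rho>(1) by (auto simp: Z_def)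
  have min: "\<rho> \<le> s" if "s > 0" "G s = 0" for s
    using \<rho>(2)[of s] \<rho>X that by (cases "s \<le> X") (auto simp: Z_def)
  have Gpos: "G x > 0" if "0 \<le> x" "x < \<rho>" for x
  proof (rule ccontr)
    assume "\<not> G x > 0"
    hence "\<exists>y\<ge>0. y \<le> x \<and> G y = 0"
      using that L G0 cont_G by (intro IVT2') auto
    then obtain y where y: "0 \<le> y" "y \<le> x" "G y = 0" by blast
    hence "y > 0" using G0 L by (cases "y = 0") auto
    thus False using min[of y] y that by simp
  qed
  have pp: "\<phi> x > 0" if "0 \<le> x" "x \<le> \<rho>" for x
  proof (cases "x = 0")
    case False
    have "G y \<ge> 0" if "0 < y" "y \<le> x" for y
      using Gpos[of y] G\<rho> that \<open>x \<le> \<rho>\<close> by (cases "y = \<rho>") auto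
    thus ?thesis using \<phi>_pos[of x] False that by auto
  qed (simp add: \<phi>0)
  have "\<forall>\<^sub>F x in at \<rho>. \<phi> x > 0"
    using D[of \<rho>] pp[of \<rho>] \<rho>0 by (intro order_tendstoD) (auto dest: DERIV_isCont simp: isCont_def)
  then obtain d where d: "d > 0" "\<And>x. x \<noteq> \<rho> \<Longrightarrow> dist x \<rho> < d \<Longrightarrow> \<phi> x > 0"
    by (auto simp: eventually_at)
  define \<rho>' where "\<rho>' = \<rho> + d"
  have pp': "\<phi> x > 0" if "0 \<le> x" "x < \<rho>'" for x
    using pp[of x] d(2)[of x] that by (cases "x \<le> \<rho>") (auto simp: \<rho>'_def dist_real_def)
  have nz: "\<Phi> w \<noteq> 0" if "w \<in> ball 0 \<rho>'" for w
    using norm_eval_ge[of w] pp'[of "norm w"] \<Phi>_real[of "norm w"] that by (auto simp: \<Phi>_def)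
  have holo\<Phi>: "\<Phi> holomorphic_on ball 0 \<rho>'"
    unfolding \<Phi>_def by (intro holomorphic_intros) (simp add: conv_radius)
  obtain l0 where l0: "l0 holomorphic_on ball 0 \<rho>'" "\<And>z. z \<in> ball 0 \<rho>' \<Longrightarrow> \<Phi> z = exp (l0 z)"
    using contractible_imp_holomorphic_log[OF holo\<Phi> _ nz] convex_imp_contractible[OF convex_ball] by metis
  \<comment> \<open>\<open>exp (l0 0) = \<Phi> 0 = 1\<close>, so the shift by \<open>l0 0\<close> keeps a logarithm of \<open>\<Phi>\<close>\<close>
  define l where "l = (\<lambda>z. l0 z - l0 0)"
  have \<rho>': "\<rho> < \<rho>'" using d by (simp add: \<rho>'_def)
  have "exp (l0 0) = 1"
    using l0(2)[of 0] \<rho>' \<rho>0 \<Phi>_real[of 0] by (simp add: \<phi>0)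
  hence l_exp: "\<Phi> w = exp (l w)" if "w \<in> ball 0 \<rho>'" for w
    using l0(2)[OF that] by (simp add: l_def exp_diff)
  have l_holo: "l holomorphic_on ball 0 \<rho>'"
    unfolding l_def by (intro holomorphic_intros l0)
  have l_deriv: "deriv l w = \<Phi>' w / \<Phi> w" if w: "w \<in> ball 0 \<rho>'" for w
  proof -
    have "(l has_field_derivative deriv l w) (at w)"
      using l_holo w holomorphic_derivI open_ball by blast
    hence "((\<lambda>w. exp (l w)) has_field_derivative exp (l w) * deriv l w) (at w)"
      by (rule DERIV_chain2[OF DERIV_exp])
    hence "(\<Phi> has_field_derivative exp (l w) * deriv l w) (at w)"
      by (rule has_field_derivative_transform_within_open[OF _ open_ball w]) (simp add: l_exp)
    moreover have "(\<Phi> has_field_derivative \<Phi>' w) (at w)"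
      unfolding \<Phi>_def \<Phi>'_def by (rule has_field_derivative_eval_fps) (simp add: conv_radius)
    ultimately have "\<Phi>' w = exp (l w) * deriv l w" by (rule DERIV_unique[rotated])
    thus ?thesis using l_exp[OF w] by simp
  qed
  have real_deriv: "of_real x * deriv l (of_real x) = of_real (x * \<phi>' x / \<phi> x)"
    if "0 \<le> x" "x < \<rho>'" for x
    using l_deriv[of "of_real x"] that by (simp add: \<Phi>_real \<Phi>'_real)
  show ?thesis
  proof (rule that[OF \<rho>0 \<rho>' l_holo _ l_exp])
    show "l 0 = 0" by (simp add: l_def)
    show "Re (w * deriv l w) > - L" if w: "norm w < \<rho>" for w
    proof -
      let ?x = "norm w"
      have x: "0 \<le> ?x" "?x < \<rho>'" using w \<rho>' by auto
      have "?x * \<phi>' ?x / \<phi> ?x > - L"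
        using Gpos[of ?x] pp[of ?x] w by (simp add: G_def field_simps)
      also have "?x * \<phi>' ?x / \<phi> ?x = Re (of_real ?x * \<Phi>' (of_real ?x) / \<Phi> (of_real ?x))"
        by (simp add: \<Phi>_real \<Phi>'_real flip: of_real_mult of_real_divide)
      also have "\<dots> \<le> Re (w * \<Phi>' w / \<Phi> w)"
        unfolding \<Phi>_def \<Phi>'_def
      proof (rule Re_log_deriv_ge)
        show "eval_fps (real_fps c) (complex_of_real y) \<noteq> 0" if "0 \<le> y" "y \<le> norm w" for y
          using pp[of y] that w \<Phi>_real[of y] by (simp add: \<Phi>_def)
      qed
      also have "w * \<Phi>' w / \<Phi> w = w * deriv l w" using l_deriv[of w] w \<rho>' by simp
      finally show ?thesis .
    qed
    show "of_real \<rho> * deriv l (of_real \<rho>) = - of_real L"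
    proof -
      have "\<rho> * \<phi>' \<rho> / \<phi> \<rho> = - L"
        using G\<rho> pp[of \<rho>] \<rho>0 by (simp add: G_def field_simps)
      thus ?thesis using real_deriv[of \<rho>] \<rho>0 \<rho>' by simp
    qed
    show "of_real \<rho> * \<Phi>' (of_real \<rho>) + of_real L * \<Phi> (of_real \<rho>) = 0"
      by (simp only: G_real G\<rho> of_real_0)
    show "\<rho> \<le> s" if "s > 0" "of_real s * \<Phi>' (of_real s) + of_real L * \<Phi> (of_real s) = 0" for s
      using that min[of s] by (simp only: G_real of_real_eq_0_iff)
  qed
qed

section \<open>Starlikeness of exponentials of the logarithm\<close>

text \<open>
  Any larger disc contains the boundary point \<open>R\<close>, where the strict inequality fails.
\<close>
lemma starlike_radius_eqI:
  assumes "\<beta> < 1" "0 < R" "ereal R < fps_conv_radius F"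
    and inside: "\<And>z. 0 < norm z \<Longrightarrow> norm z < R \<Longrightarrow>
      eval_fps F z \<noteq> 0 \<and> Re (z * eval_fps (fps_deriv F) z / eval_fps F z) > \<beta>"
    and boundary: "Re (of_real R * eval_fps (fps_deriv F) (of_real R) / eval_fps F (of_real R)) \<le> \<beta>"
  shows "starlike_radius \<beta> F = ereal R"
  unfolding starlike_radius_def
proof (rule antisym)
  let ?S = "{r. 0 < r \<and> ereal r < fps_conv_radius F \<and>
       (\<forall>z \<in> ball 0 r. if z = 0 then 1 > \<beta>
          else eval_fps F z \<noteq> 0 \<and> Re (z * eval_fps (fps_deriv F) z / eval_fps F z) > \<beta>)}"
  show "ereal R \<le> Sup (ereal ` ?S)"
    using assms by (intro Sup_upper imageI) auto
  show "Sup (ereal ` ?S) \<le> ereal R"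
  proof (rule Sup_least)
    fix x assume "x \<in> ereal ` ?S"
    then obtain r where r: "x = ereal r" "r \<in> ?S" by blast
    have "r \<le> R"
    proof (rule ccontr)
      assume "\<not> r \<le> R"
      hence "complex_of_real R \<in> ball 0 r" using assms(2) by simp
      hence "Re (of_real R * eval_fps (fps_deriv F) (of_real R) / eval_fps F (of_real R)) > \<beta>"
        using r(2) assms(2) by fastforce
      thus False using boundary by simp
    qed
    thus "x \<le> ereal R" using r by simp
  qed
qed

text \<open>
  All three normalised functions have the form \<open>z exp (\<kappa> l(z\<^sup>m))\<close> with \<open>l\<close> a logarithm of \<open>\<Phi>\<close>:
  \<open>\<kappa> = 1 / \<nu>, m = 2\<close> for \<open>f\<close>, \<open>\<kappa> = 1, m = 2\<close> for \<open>g\<close> and \<open>\<kappa> = m = 1\<close> for \<open>h\<close>. For such a function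
  \<open>z F'(z) / F(z) = 1 + \<kappa> m (w l'(w))\<close> at \<open>w = z\<^sup>m\<close>, so its real part exceeds \<open>\<beta>\<close> if and only if
  \<open>Re (w l'(w)) > - L\<close> with \<open>L = (1 - \<beta>) / (\<kappa> m)\<close>.
\<close>
lemma starlike_radius_power_exp:
  fixes c :: "nat \<Rightarrow> real" and \<beta> \<kappa> :: real and m :: nat
  defines "\<Phi> \<equiv> eval_fps (real_fps c :: complex fps)"
    and "\<Phi>' \<equiv> eval_fps (fps_deriv (real_fps c) :: complex fps)"
  assumes c: "pos_limit c" "c 0 = 1" "c 1 < 0" and \<beta>: "\<beta> < 1" and \<kappa>: "\<kappa> > 0" and m: "m > 0"
  obtains F R l where "0 < R" "starlike_radius \<beta> F = ereal R"
    "fps_conv_radius F > 0" "fps_nth F 0 = 0" "fps_nth F 1 = 1"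
    "(l \<longlongrightarrow> 0) (nhds 0)"
    "\<forall>\<^sub>F z in nhds 0. \<Phi> (z ^ m) = exp (l z) \<and> eval_fps F z = z * exp (of_real \<kappa> * l z)"
    "\<Phi> (of_real (R ^ m)) \<noteq> 0"
    "of_real (R ^ m) * \<Phi>' (of_real (R ^ m)) + of_real ((1 - \<beta>) / (\<kappa> * real m)) * \<Phi> (of_real (R ^ m)) = 0"
    "\<And>s. s > 0 \<Longrightarrow> of_real (s ^ m) * \<Phi>' (of_real (s ^ m))
        + of_real ((1 - \<beta>) / (\<kappa> * real m)) * \<Phi> (of_real (s ^ m)) = 0 \<Longrightarrow> R \<le> s"
proof -
  define L where "L = (1 - \<beta>) / (\<kappa> * real m)"
  have L: "L > 0" using \<beta> \<kappa> m by (simp add: L_def)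
  have L\<beta>: "\<kappa> * real m * L = 1 - \<beta>" using \<kappa> m by (simp add: L_def)
  obtain \<rho> \<rho>' l where core: "0 < \<rho>" "\<rho> < \<rho>'" "l holomorphic_on ball 0 \<rho>'" "l 0 = 0"
    "\<And>w. w \<in> ball 0 \<rho>' \<Longrightarrow> \<Phi> w = exp (l w)"
    "\<And>w. norm w < \<rho> \<Longrightarrow> Re (w * deriv l w) > - L"
    "of_real \<rho> * deriv l (of_real \<rho>) = - of_real L"
    "of_real \<rho> * \<Phi>' (of_real \<rho>) + of_real L * \<Phi> (of_real \<rho>) = 0"
    "\<And>s. s > 0 \<Longrightarrow> of_real s * \<Phi>' (of_real s) + of_real L * \<Phi> (of_real s) = 0 \<Longrightarrow> \<rho> \<le> s"
    using pos_limit_smallest_root_log[OF c L] unfolding \<Phi>_def \<Phi>'_def by metis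
  define R where "R = root m \<rho>"
  define R' where "R' = root m \<rho>'"
  have R: "R > 0" "R ^ m = \<rho>" using core(1) m by (simp_all add: R_def)
  have R': "R' > 0" "R' ^ m = \<rho>'" "R < R'" using core(1,2) m by (simp_all add: R_def R'_def)
  have in_ball: "z ^ m \<in> ball 0 \<rho>'" if "norm z < R'" for z :: complex
    using power_strict_mono[of "norm z" R' m] that m R' by (simp add: norm_power)
  define f where "f = (\<lambda>z. z * exp (of_real \<kappa> * l (z ^ m)))"
  have f_holo: "f holomorphic_on ball 0 R'"
    unfolding f_def
    by (intro holomorphic_intros holomorphic_on_compose_gen[OF _ core(3), unfolded o_def])
      (use in_ball in auto)
  have f_deriv: "(f has_field_derivative
      exp (of_real \<kappa> * l (z ^ m)) * (1 + of_real (\<kappa> * real m) * (z ^ m * deriv l (z ^ m)))) (at z)"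
    if z: "norm z < R'" for z
  proof -
    have "(l has_field_derivative deriv l (z ^ m)) (at (z ^ m))"
      using core(3) in_ball[OF z] holomorphic_derivI open_ball by blast
    hence d: "((\<lambda>z. l (z ^ m)) has_field_derivative deriv l (z ^ m) * (of_nat m * z ^ (m - 1))) (at z)"
      by (rule DERIV_chain2) (auto intro!: derivative_eq_intros)
    have "z * z ^ (m - 1) = z ^ m" using m by (cases m) auto
    hence "1 * exp (of_real \<kappa> * l (z ^ m)) + z * (exp (of_real \<kappa> * l (z ^ m)) *
        (of_real \<kappa> * (deriv l (z ^ m) * (of_nat m * z ^ (m - 1))))) =
        exp (of_real \<kappa> * l (z ^ m)) * (1 + of_real (\<kappa> * real m) * (z ^ m * deriv l (z ^ m)))"
      by (simp add: algebra_simps)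
    moreover have "(f has_field_derivative 1 * exp (of_real \<kappa> * l (z ^ m)) + z * (exp (of_real \<kappa> * l (z ^ m)) *
        (of_real \<kappa> * (deriv l (z ^ m) * (of_nat m * z ^ (m - 1)))))) (at z)"
      unfolding f_def by (rule derivative_eq_intros refl d | simp)+
    ultimately show ?thesis by metis
  qed
  define F where "F = fps_expansion f 0"
  have f_holo': "f holomorphic_on eball 0 (ereal R')" using f_holo by simp
  have rad: "fps_conv_radius F \<ge> ereal R'"
    unfolding F_def by (rule conv_radius_fps_expansion) (rule f_holo')
  have rad0: "fps_conv_radius F > 0" using rad R'(1) by (meson ereal_less(2) less_le_trans)
  have evalF: "eval_fps F z = f z" if "norm z < R'" for z
    unfolding F_def using eval_fps_expansion'[OF f_holo', of z] that by simp
  have evalF': "eval_fps (fps_deriv F) z =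
      exp (of_real \<kappa> * l (z ^ m)) * (1 + of_real (\<kappa> * real m) * (z ^ m * deriv l (z ^ m)))"
    if z: "norm z < R'" for z
  proof -
    have "ereal (norm z) < fps_conv_radius F" using z rad by (meson ereal_less_eq(3) less_ereal.simps(1) less_le_trans)
    hence "(eval_fps F has_field_derivative eval_fps (fps_deriv F) z) (at z)"
      by (rule has_field_derivative_eval_fps)
    hence "(f has_field_derivative eval_fps (fps_deriv F) z) (at z)"
      by (rule has_field_derivative_transform_within_open[OF _ open_ball[of 0 R']]) (use z evalF in auto)
    thus ?thesis using f_deriv[OF z] DERIV_unique by blast
  qed
  have quot: "z * eval_fps (fps_deriv F) z / eval_fps F z =
      1 + of_real (\<kappa> * real m) * (z ^ m * deriv l (z ^ m))" if "norm z < R'" "z \<noteq> 0" for z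
    using evalF[OF that(1)] evalF'[OF that(1)] that(2) by (simp add: f_def)
  have "starlike_radius \<beta> F = ereal R"
  proof (rule starlike_radius_eqI[OF \<beta> R(1)])
    show "ereal R < fps_conv_radius F" using rad R'(3) by (meson less_ereal.simps(1) less_le_trans)
    show "eval_fps F z \<noteq> 0 \<and> Re (z * eval_fps (fps_deriv F) z / eval_fps F z) > \<beta>"
      if z: "0 < norm z" "norm z < R" for z
    proof -
      have "norm (z ^ m) < \<rho>" using power_strict_mono[of "norm z" R m] z m R by (simp add: norm_power)
      from mult_strict_left_mono[OF core(6)[OF this], of "\<kappa> * real m"]
      have "\<kappa> * real m * Re (z ^ m * deriv l (z ^ m)) > - (\<kappa> * real m * L)" using \<kappa> m by simp
      hence "Re (1 + of_real (\<kappa> * real m) * (z ^ m * deriv l (z ^ m))) > \<beta>"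
        unfolding L\<beta> by simp
      thus ?thesis using quot[of z] evalF[of z] z R'(3) by (auto simp: f_def)
    qed
    have "of_real R * eval_fps (fps_deriv F) (of_real R) / eval_fps F (of_real R) =
        1 + of_real (\<kappa> * real m) * (of_real \<rho> * deriv l (of_real \<rho>))"
      using quot[of "of_real R"] R R'(3) by (simp flip: of_real_power)
    also have "\<dots> = of_real (1 - \<kappa> * real m * L)" unfolding core(7) by simp
    also have "\<dots> = of_real \<beta>" unfolding L\<beta> by simp
    finally show "Re (of_real R * eval_fps (fps_deriv F) (of_real R) / eval_fps F (of_real R)) \<le> \<beta>"
      by simp
  qed
  moreover have "((\<lambda>z. l (z ^ m)) \<longlongrightarrow> 0) (nhds 0)"
  proof -
    have "isCont (\<lambda>z. l (z ^ m)) 0"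
    proof (rule isCont_o2[where g = l])
      show "isCont l (0 ^ m)"
        using holomorphic_on_imp_continuous_on[OF core(3)] m core(1,2)
        by (simp add: continuous_on_eq_continuous_at zero_power)
    qed auto
    thus ?thesis using m core(4) by (simp add: continuous_at tendsto_nhds_iff zero_power)
  qed
  moreover have "\<forall>\<^sub>F z in nhds 0. \<Phi> (z ^ m) = exp (l (z ^ m)) \<and> eval_fps F z = z * exp (of_real \<kappa> * l (z ^ m))"
  proof -
    have "\<forall>\<^sub>F z :: complex in nhds 0. z \<in> ball 0 R'"
      using R'(1) by (intro eventually_nhds_in_open) auto
    thus ?thesis by eventually_elim (use evalF core(5) in_ball in \<open>auto simp: f_def\<close>)
  qed
  moreover have "fps_nth F 0 = 0"
    using evalF[of 0] R'(1) by (simp add: eval_fps_at_0 f_def)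
  moreover have "fps_nth F 1 = 1"
    using evalF'[of 0] R'(1) m core(4) by (simp add: eval_fps_at_0 zero_power)
  moreover have "\<Phi> (of_real (R ^ m)) \<noteq> 0"
    using core(5)[of "of_real \<rho>"] core(1,2) by (simp add: R(2) del: of_real_power)
  moreover have "R \<le> s" if "s > 0" "of_real (s ^ m) * \<Phi>' (of_real (s ^ m))
        + of_real L * \<Phi> (of_real (s ^ m)) = 0" for s
  proof -
    have "\<rho> \<le> s ^ m" using core(9)[of "s ^ m"] that by simp
    thus ?thesis using that(1) R m by (metis less_imp_le power_mono_iff)
  qed
  moreover have "of_real (R ^ m) * \<Phi>' (of_real (R ^ m)) + of_real L * \<Phi> (of_real (R ^ m)) = 0"
    unfolding R(2) by (rule core(8))
  ultimately show ?thesis using that[of R F "\<lambda>z. l (z ^ m)"] R(1) rad0 unfolding L_def by blast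
qed

section \<open>Power series determined by their values in the right half-plane\<close>

abbreviation half_plane :: "complex set" where "half_plane \<equiv> {z. Re z > 0}"

lemma zero_islimpt_half_plane_ball:
  assumes "r > 0"
  shows "0 islimpt {z \<in> ball 0 r. Re z > 0}"
  unfolding islimpt_approachable
proof (intro allI impI)
  fix e :: real assume "e > 0"
  thus "\<exists>x'\<in>{z \<in> ball 0 r. Re z > 0}. x' \<noteq> 0 \<and> dist x' 0 < e"
    using assms by (intro bexI[of _ "of_real (min e r / 2)"]) auto
qed

lemma fps_eq_if_eval_eq_half_plane:
  fixes F G :: "complex fps"
  assumes rad: "fps_conv_radius F > 0" "fps_conv_radius G > 0"
    and ev: "\<forall>\<^sub>F z in at 0 within half_plane. eval_fps F z = eval_fps G z"
  shows "F = G"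
proof -
  obtain d where d: "d > 0" "\<And>z. Re z > 0 \<Longrightarrow> z \<noteq> 0 \<Longrightarrow> norm z < d \<Longrightarrow> eval_fps F z = eval_fps G z"
    using ev by (auto simp: eventually_at)
  obtain r0 where r0: "0 < ereal r0" "ereal r0 < min (fps_conv_radius F) (fps_conv_radius G)"
    using ereal_dense2[of 0 "min (fps_conv_radius F) (fps_conv_radius G)"] rad by auto
  define r where "r = min d r0"
  have r: "r > 0" "r \<le> d" "r \<le> r0" using d(1) r0(1) by (auto simp: r_def)
  have sub: "(ball 0 r :: complex set) \<subseteq> eball 0 (fps_conv_radius H)" if "H \<in> {F, G}" for H :: "complex fps"
  proof
    fix z :: complex assume "z \<in> ball 0 r"
    hence "ereal (norm z) < ereal r0" using r by simp
    also have "\<dots> < fps_conv_radius H" using r0(2) that by auto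
    finally show "z \<in> eball 0 (fps_conv_radius H)" by (simp add: in_eball_iff)
  qed
  have zero: "eval_fps F z - eval_fps G z = 0" if "z \<in> ball 0 r" for z
  proof (rule analytic_continuation[of "\<lambda>z. eval_fps F z - eval_fps G z" "ball 0 r"
        "{z \<in> ball 0 r. Re z > 0}" 0 z])
    show "(\<lambda>z. eval_fps F z - eval_fps G z) holomorphic_on ball 0 r"
      using sub by (intro holomorphic_intros) auto
    show "eval_fps F z - eval_fps G z = 0" if "z \<in> {z \<in> ball 0 r. Re z > 0}" for z
      using that d(2)[of z] r by (cases "z = 0") auto
    show "(0 :: complex) islimpt {z \<in> ball 0 r. Re z > 0}"
      by (rule zero_islimpt_half_plane_ball[OF r(1)])
  qed (use r that in auto)
  have "\<forall>\<^sub>F z :: complex in nhds 0. z \<in> ball 0 r"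
    using r by (intro eventually_nhds_in_open) auto
  hence "\<forall>\<^sub>F z in nhds 0. eval_fps F z = eval_fps G z"
    by eventually_elim (use zero in auto)
  thus ?thesis by (rule eval_fps_eqD[OF rad])
qed

text \<open>
  In the right half-plane \<open>Ln z\<close> has imaginary part below \<open>\<pi>/2\<close> in modulus, so adding \<open>u\<close> does not
  cross the branch cut.
\<close>
lemma powr_mult_exp_half_plane:
  assumes "Re z > 0" "\<bar>Im u\<bar> < pi / 2"
  shows "(z * exp u) powr s = z powr s * exp (s * u)"
proof -
  have z: "z \<noteq> 0" using assms(1) by auto
  have "\<bar>Im (Ln z)\<bar> < pi / 2" using Re_Ln_pos_lt[OF z] assms(1) by blast
  hence "Ln (exp (Ln z + u)) = Ln z + u"
    using assms(2) by (intro Ln_exp) auto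
  hence "Ln (z * exp u) = Ln z + u" using z by (simp add: exp_add)
  thus ?thesis using z by (simp add: powr_def exp_add ring_distribs)
qed

lemma eval_fps_eq_mult_exp:
  fixes F :: "complex fps"
  assumes rad: "fps_conv_radius F > 0" and F: "fps_nth F 0 = 0" "fps_nth F 1 = 1"
  obtains u where "(u \<longlongrightarrow> 0) (nhds 0)" "\<forall>\<^sub>F z in nhds 0. eval_fps F z = z * exp (u z)"
proof -
  define G where "G = fps_shift 1 F"
  have FG: "F = G * fps_X" 
  proof (rule fps_ext)
    fix n show "fps_nth F n = fps_nth (G * fps_X) n"
      using F(1) by (cases n) (auto simp: G_def)
  qed
  have radG: "fps_conv_radius G > 0" unfolding G_def using rad by simp
  have cont: "isCont (eval_fps G) 0" by (rule continuous_eval_fps) (use radG in \<open>simp add: zero_ereal_def\<close>)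
  have G0: "eval_fps G 0 = 1" using F(2) by (simp add: eval_fps_at_0 G_def)
  have lim: "(eval_fps G \<longlongrightarrow> 1) (nhds 0)" using cont G0 by (simp add: continuous_at tendsto_nhds_iff)
  have "((\<lambda>z. Ln (eval_fps G z)) \<longlongrightarrow> Ln 1) (nhds 0)"
    by (rule tendsto_Ln[OF lim]) auto
  moreover have "\<forall>\<^sub>F z in nhds 0. eval_fps F z = z * exp (Ln (eval_fps G z))"
  proof -
    have "\<forall>\<^sub>F z in nhds 0. eval_fps G z \<noteq> 0"
      using tendsto_imp_eventually_ne[OF lim] by simp
    moreover have "\<forall>\<^sub>F z :: complex in nhds 0. z \<in> eball 0 (fps_conv_radius G)"
      using radG by (intro eventually_nhds_in_open) (auto simp: in_eball_iff zero_ereal_def)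
    ultimately show ?thesis
      by eventually_elim (simp add: FG eval_fps_mult in_eball_iff)
  qed
  ultimately show ?thesis using that[of "\<lambda>z. Ln (eval_fps G z)"] by simp
qed

lemma eventually_nhds_imp_half_plane:
  "\<forall>\<^sub>F z in nhds 0. P z \<Longrightarrow> \<forall>\<^sub>F z in at 0 within half_plane. P z \<and> Re z > 0"
  unfolding eventually_at_filter by (auto elim!: eventually_mono)

text \<open>
  Writing both germs as \<open>z exp (u z)\<close> and \<open>z exp (v z)\<close> with small \<open>u\<close> and \<open>v\<close>, equal powers give
  \<open>exp (\<nu> u) = exp (\<nu> v)\<close>, and \<open>exp\<close> is injective near \<open>0\<close>.
\<close>
lemma powr_branch_unique:
  fixes F G :: "complex fps"
  assumes F: "fps_conv_radius F > 0" "fps_nth F 0 = 0" "fps_nth F 1 = 1"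
    and G: "fps_conv_radius G > 0" "fps_nth G 0 = 0" "fps_nth G 1 = 1"
    and \<nu>: "\<nu> \<noteq> 0"
    and eq: "\<forall>\<^sub>F z in at 0 within half_plane. eval_fps F z powr of_real \<nu> = eval_fps G z powr of_real \<nu>"
  shows "F = G"
proof -
  obtain u where u: "(u \<longlongrightarrow> 0) (nhds 0)" "\<forall>\<^sub>F z in nhds 0. eval_fps F z = z * exp (u z)"
    using eval_fps_eq_mult_exp[OF F] by metis
  obtain v where v: "(v \<longlongrightarrow> 0) (nhds 0)" "\<forall>\<^sub>F z in nhds 0. eval_fps G z = z * exp (v z)"
    using eval_fps_eq_mult_exp[OF G] by metis
  have small: "\<forall>\<^sub>F z in nhds 0. \<bar>Im (w z)\<bar> < pi / 2 \<and> \<bar>\<nu> * Im (w z)\<bar> < pi"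
    if "(w \<longlongrightarrow> 0) (nhds 0)" for w :: "complex \<Rightarrow> complex"
  proof -
    have "((\<lambda>z. \<bar>Im (w z)\<bar>) \<longlongrightarrow> 0) (nhds 0)" using that by (auto intro!: tendsto_eq_intros)
    hence 1: "\<forall>\<^sub>F z in nhds 0. \<bar>Im (w z)\<bar> < pi / 2" by (rule order_tendstoD) simp
    have "((\<lambda>z. \<bar>\<nu> * Im (w z)\<bar>) \<longlongrightarrow> 0) (nhds 0)" using that by (auto intro!: tendsto_eq_intros)
    hence 2: "\<forall>\<^sub>F z in nhds 0. \<bar>\<nu> * Im (w z)\<bar> < pi" by (rule order_tendstoD) simp
    from 1 2 show ?thesis by eventually_elim simp
  qed
  have "\<forall>\<^sub>F z in nhds 0. (eval_fps F z = z * exp (u z) \<and> eval_fps G z = z * exp (v z)) \<and>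
     (\<bar>Im (u z)\<bar> < pi / 2 \<and> \<bar>\<nu> * Im (u z)\<bar> < pi) \<and> (\<bar>Im (v z)\<bar> < pi / 2 \<and> \<bar>\<nu> * Im (v z)\<bar> < pi)"
    by (intro eventually_conj u v small)
  from eventually_nhds_imp_half_plane[OF this] eq
  have "\<forall>\<^sub>F z in at 0 within half_plane. eval_fps F z = eval_fps G z"
  proof eventually_elim
    case (elim z)
    have "z \<noteq> 0" using elim by auto
    hence z: "z powr of_real \<nu> \<noteq> 0" by simp
    have "z powr of_real \<nu> * exp (of_real \<nu> * u z) = z powr of_real \<nu> * exp (of_real \<nu> * v z)"
      using elim powr_mult_exp_half_plane[of z "u z" "of_real \<nu>"]
        powr_mult_exp_half_plane[of z "v z" "of_real \<nu>"] by metis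
    hence "exp (of_real \<nu> * u z) = exp (of_real \<nu> * v z)" using z by simp
    hence "of_real \<nu> * u z = of_real \<nu> * v z"
    proof (rule exp_complex_eqI[rotated])
      show "\<bar>Im (of_real \<nu> * u z) - Im (of_real \<nu> * v z)\<bar> < 2 * pi"
        using elim by (simp add: abs_if split: if_splits)
    qed
    thus ?case using elim \<nu> by simp
  qed
  thus ?thesis by (rule fps_eq_if_eval_eq_half_plane[OF F(1) G(1)])
qed

section \<open>Positivity of the zeros of \<open>\<Phi>\<close>\<close>

lemma Q_poly_alt: "Q_poly a b c x = a * x ^ 2 + (b - a) * x + c"
  by (simp add: Q_poly_def power2_eq_square algebra_simps)

lemma finite_Q_poly_roots:
  assumes "Q_poly a b c \<nu> \<noteq> 0"
  shows "finite {x. Q_poly a b c x = 0}"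
proof -
  have e: "Q_poly a b c x = poly [:c, b - a, a:] x" for x
    by (simp add: Q_poly_alt power2_eq_square algebra_simps)
  hence "[:c, b - a, a:] \<noteq> 0" using assms by (metis poly_0)
  thus ?thesis unfolding e by (rule poly_roots_finite)
qed

lemma nu_bound_ge_0: "nu_bound a b c \<ge> 0"
  by (simp add: nu_bound_def)

lemma Q_poly_root_less:
  assumes "Q_poly a b c \<nu> \<noteq> 0" "\<nu> \<ge> nu_bound a b c" "Q_poly a b c x = 0"
  shows "x < \<nu>"
proof -
  have "x \<le> Max {x. Q_poly a b c x = 0}"
    using finite_Q_poly_roots[OF assms(1)] assms(3) by (intro Max_ge) auto
  hence "x \<le> nu_bound a b c" using assms(3) by (auto simp: nu_bound_def)
  moreover have "x \<noteq> \<nu>" using assms by auto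
  ultimately show ?thesis using assms(2) by linarith
qed

text \<open>
  The coefficients of the entire function \<open>\<Phi>\<close> for which the normalised \<open>N\<^sub>\<nu>(z)\<close> is \<open>z\<^sup>\<nu> \<Phi>(z\<^sup>2)\<close>: the
  Euler operator \<open>z d/dz\<close> multiplies \<open>z\<^bsup>\<nu> + 2 k\<^esup>\<close> by \<open>\<nu> + 2 k\<close>.
\<close>
definition N_coeff :: "real \<Rightarrow> real \<Rightarrow> real \<Rightarrow> real \<Rightarrow> nat \<Rightarrow> real" where
  "N_coeff a b c \<nu> k = Q_poly a b c (\<nu> + 2 * real k) / Q_poly a b c \<nu> * bessel_coeff \<nu> k"

lemma bessel_coeff_rec:
  assumes "\<nu> > -1"
  shows "bessel_coeff \<nu> k = - 4 * real (Suc k) * (\<nu> + real (Suc k)) * bessel_coeff \<nu> (Suc k)"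
proof -
  have nz: "real (Suc k) > 0" "\<nu> + real (Suc k) > 0" using assms by simp_all
  have "bessel_coeff \<nu> (Suc k) =
      bessel_coeff \<nu> k * (- 1 / (4 * real (Suc k) * (\<nu> + real (Suc k))))"
    by (simp add: bessel_coeff_def pochhammer_Suc mult_ac add_ac)
  also have "- 4 * real (Suc k) * (\<nu> + real (Suc k)) * \<dots> = bessel_coeff \<nu> k"
    using nz by (simp add: divide_simps del: of_nat_Suc)
  finally show ?thesis by simp
qed

text \<open>
  Bessel's equation turns \<open>a z\<^sup>2 J'' + b z J' + c J\<close> into \<open>(b - a) z J' + (c + a \<nu>\<^sup>2 - a z\<^sup>2) J\<close>, which in
  the variable \<open>w = z\<^sup>2\<close> is a single step of the operator with \<open>\<kappa> = 2\<close> and \<open>\<delta> = a / (b - a)\<close>.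
\<close>
lemma pos_limit_N_coeff_ode:
  assumes \<nu>: "\<nu> > -1" and ba: "b \<noteq> a"
    and \<alpha>: "Q_poly a b c \<nu> / (b - a) > 0" and \<delta>: "a / (b - a) \<ge> 0"
  shows "pos_limit (N_coeff a b c \<nu>)"
proof (rule pos_limit_step[OF pos_limit_bessel[OF \<nu>] \<alpha> _ \<delta>, of 2])
  fix k
  have Q: "Q_poly a b c \<nu> \<noteq> 0" using \<alpha> by auto
  have "Q_poly a b c (\<nu> + 2 * real k) * bessel_coeff \<nu> k =
      (Q_poly a b c \<nu> + 2 * (b - a) * real k) * bessel_coeff \<nu> k
      - a * (if k = 0 then 0 else bessel_coeff \<nu> (k - 1))"
  proof (cases k)
    case (Suc j)
    have "Q_poly a b c (\<nu> + 2 * real k) =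
        Q_poly a b c \<nu> + 2 * (b - a) * real k + a * (4 * real k * (\<nu> + real k))"
      by (simp add: Q_poly_alt power2_eq_square algebra_simps)
    thus ?thesis by (simp add: Suc bessel_coeff_rec[OF \<nu>, of j] algebra_simps)
  qed simp
  moreover define p where "p = b - a"
  moreover have "p \<noteq> 0" using ba by (simp add: p_def)
  ultimately show "Q_poly a b c \<nu> / (b - a) * N_coeff a b c \<nu> k =
      (Q_poly a b c \<nu> / (b - a) + 2 * real k) * bessel_coeff \<nu> k
      - a / (b - a) * (if k = 0 then 0 else bessel_coeff \<nu> (k - 1))"
    using Q by (simp add: N_coeff_def divide_simps)
qed simp

lemma pos_limit_linear_factor:
  assumes "pos_limit x" "s > 0"
  shows "pos_limit (\<lambda>k. (1 + 2 * real k / s) * x k)"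
proof (rule pos_limit_step[OF assms, of 2 0])
  fix k
  have "s * (1 + 2 * real k / s) = s + 2 * real k"
    using assms(2) by (simp add: distrib_left)
  thus "s * ((1 + 2 * real k / s) * x k) =
      (s + 2 * real k) * x k - 0 * (if k = 0 then 0 else x (k - 1))"
    by (simp flip: mult.assoc)
qed auto

text \<open>
  If \<open>Q\<close> splits over the reals, each of its two linear factors is one step of the operator.
\<close>
lemma pos_limit_N_coeff_factor:
  assumes \<nu>: "\<nu> > -1" and a: "a \<noteq> 0" and r: "r1 < \<nu>" "r2 < \<nu>"
    and Q: "\<And>x. Q_poly a b c x = a * (x - r1) * (x - r2)"
  shows "pos_limit (N_coeff a b c \<nu>)"
proof -
  have "pos_limit (\<lambda>k. (1 + 2 * real k / (\<nu> - r2)) * ((1 + 2 * real k / (\<nu> - r1)) * bessel_coeff \<nu> k))"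
    using r by (intro pos_limit_linear_factor pos_limit_bessel[OF \<nu>]) auto
  also have "(\<lambda>k. (1 + 2 * real k / (\<nu> - r2)) * ((1 + 2 * real k / (\<nu> - r1)) * bessel_coeff \<nu> k))
      = N_coeff a b c \<nu>"
  proof
    fix k
    have "1 + 2 * real k / (\<nu> - r1) = (\<nu> + 2 * real k - r1) / (\<nu> - r1)"
      "1 + 2 * real k / (\<nu> - r2) = (\<nu> + 2 * real k - r2) / (\<nu> - r2)"
      using r by (simp_all add: field_simps)
    thus "(1 + 2 * real k / (\<nu> - r2)) * ((1 + 2 * real k / (\<nu> - r1)) * bessel_coeff \<nu> k) = N_coeff a b c \<nu> k"
      using a by (simp add: N_coeff_def Q mult_ac)
  qed
  finally show ?thesis .
qed

text \<open>
  If \<open>Q\<close> has degree at most one, or has no real roots (which forces \<open>a\<close>, \<open>c\<close> and \<open>b - a\<close> to be positive),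
  Bessel's equation applies; otherwise the roots of \<open>Q\<close> are real and lie below \<open>\<nu>\<close>.
\<close>
lemma pos_limit_N_coeff:
  assumes par: "(c = 0 \<and> a \<noteq> b) \<or> (c > 0 \<and> a < b)"
    and Q: "Q_poly a b c \<nu> \<noteq> 0" and \<nu>: "\<nu> \<ge> nu_bound a b c"
  shows "pos_limit (N_coeff a b c \<nu>)"
proof -
  have \<nu>0: "\<nu> \<ge> 0" using \<nu> nu_bound_ge_0[of a b c] by linarith
  define D where "D = (b - a) ^ 2 - 4 * a * c"
  consider "a = 0" | "a \<noteq> 0" "D \<ge> 0" | "D < 0" by linarith
  thus ?thesis
  proof cases
    case 1
    show ?thesis
    proof (rule pos_limit_N_coeff_ode)
      have "b \<noteq> 0" using 1 par by auto
      have "Q_poly a b c \<nu> / (b - a) = \<nu> + c / b" using 1 \<open>b \<noteq> 0\<close> by (simp add: Q_poly_alt add_divide_distrib)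
      moreover have "Q_poly a b c \<nu> / (b - a) \<noteq> 0" using Q 1 \<open>b \<noteq> 0\<close> by simp
      moreover have "c / b \<ge> 0" using par 1 by auto
      ultimately show "Q_poly a b c \<nu> / (b - a) > 0" using \<nu>0 by linarith
    qed (use 1 par \<nu>0 in auto)
  next
    case 2
    define r1 where "r1 = (a - b + sqrt D) / (2 * a)"
    define r2 where "r2 = (a - b - sqrt D) / (2 * a)"
    have s: "sqrt D * sqrt D = D" using 2 by simp
    have "(a - b + sqrt D) * (a - b - sqrt D) = 4 * a * c"
      using s by (simp add: D_def power2_eq_square algebra_simps)
    hence vieta: "a * (r1 * r2) = c" "a * (r1 + r2) = a - b"
      using 2 by (simp_all add: r1_def r2_def field_simps)
    have f: "Q_poly a b c x = a * (x - r1) * (x - r2)" for x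
    proof -
      have "Q_poly a b c x = a * x ^ 2 - (a * (r1 + r2)) * x + a * (r1 * r2)"
        unfolding Q_poly_alt vieta by (simp add: algebra_simps)
      also have "\<dots> = a * (x - r1) * (x - r2)"
        by (simp add: power2_eq_square algebra_simps)
      finally show ?thesis .
    qed
    show ?thesis
    proof (rule pos_limit_N_coeff_factor[OF _ _ _ _ f])
      show "r1 < \<nu>" "r2 < \<nu>" using f by (auto intro!: Q_poly_root_less[OF Q \<nu>])
    qed (use 2 \<nu>0 in auto)
  next
    case 3
    hence "4 * (a * c) > (b - a) ^ 2" by (simp add: D_def)
    moreover have "(b - a) ^ 2 \<ge> 0" by simp
    ultimately have "a * c > 0" by linarith
    hence ac: "c > 0" "a > 0" "a < b" using par by (auto simp: zero_less_mult_iff)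
    have "Q_poly a b c \<nu> > 0"
      unfolding Q_poly_alt using ac \<nu>0 by (intro add_nonneg_pos add_nonneg_nonneg mult_nonneg_nonneg) auto
    thus ?thesis using ac \<nu>0 by (intro pos_limit_N_coeff_ode) auto
  qed
qed

lemma N_coeff_0: "Q_poly a b c \<nu> \<noteq> 0 \<Longrightarrow> N_coeff a b c \<nu> 0 = 1"
  by (simp add: N_coeff_def bessel_coeff_def)

text \<open>
  There is no root of \<open>Q\<close> between \<open>\<nu>\<close> and \<open>\<nu> + 2\<close>, so \<open>Q\<close> has the same sign at both points.
\<close>
lemma N_coeff_1_neg:
  assumes Q: "Q_poly a b c \<nu> \<noteq> 0" and \<nu>: "\<nu> \<ge> nu_bound a b c"
  shows "N_coeff a b c \<nu> 1 < 0"
proof -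
  have \<nu>0: "\<nu> \<ge> 0" using \<nu> nu_bound_ge_0[of a b c] by linarith
  have "Q_poly a b c \<nu> * Q_poly a b c (\<nu> + 2) > 0"
  proof (rule ccontr)
    assume neg: "\<not> Q_poly a b c \<nu> * Q_poly a b c (\<nu> + 2) > 0"
    have "\<exists>x\<ge>\<nu>. x \<le> \<nu> + 2 \<and> Q_poly a b c \<nu> * Q_poly a b c x = 0"
      using neg by (intro IVT2') (auto simp: Q_poly_def intro!: continuous_intros)
    thus False using Q Q_poly_root_less[OF Q \<nu>] by force
  qed
  hence "Q_poly a b c (\<nu> + 2) / Q_poly a b c \<nu> > 0"
    by (auto simp: zero_less_mult_iff zero_less_divide_iff)
  moreover have "bessel_coeff \<nu> 1 < 0" using \<nu>0 by (simp add: bessel_coeff_def)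
  ultimately have "Q_poly a b c (\<nu> + 2) / Q_poly a b c \<nu> * bessel_coeff \<nu> 1 < 0"
    by (rule mult_pos_neg)
  thus ?thesis by (simp add: N_coeff_def)
qed

section \<open>Bessel functions and their derivatives on the right half-plane\<close>

definition entire_coeff :: "(nat \<Rightarrow> real) \<Rightarrow> bool" where
  "entire_coeff x \<longleftrightarrow> fps_conv_radius (real_fps x :: complex fps) = \<infinity>"

lemma entire_coeff_lincomb:
  assumes "entire_coeff x" "entire_coeff y"
  shows "entire_coeff (\<lambda>k. p * x k + q * y k)"
    and "eval_fps (real_fps (\<lambda>k. p * x k + q * y k)) z =
      of_real p * eval_fps (real_fps x) z + of_real q * eval_fps (real_fps y) (z :: complex)"
proof -
  have e: "(real_fps (\<lambda>k. p * x k + q * y k) :: complex fps) =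
      fps_const (of_real p) * real_fps x + fps_const (of_real q) * real_fps y"
    by (rule fps_ext) simp
  have inf: "fps_conv_radius (fps_const (complex_of_real s) * real_fps w) = \<infinity>" if "entire_coeff w" for s w
    using fps_conv_radius_mult[of "fps_const (complex_of_real s)" "real_fps w"] that
    by (simp add: entire_coeff_def)
  show "entire_coeff (\<lambda>k. p * x k + q * y k)"
    using fps_conv_radius_add[of "fps_const (complex_of_real p) * real_fps x" "fps_const (complex_of_real q) * real_fps y"]
      inf[OF assms(1), of p] inf[OF assms(2), of q] by (simp add: entire_coeff_def e)
  show "eval_fps (real_fps (\<lambda>k. p * x k + q * y k)) z =
      of_real p * eval_fps (real_fps x) z + of_real q * eval_fps (real_fps y) z"
    unfolding e using inf assms by (simp add: eval_fps_add eval_fps_mult entire_coeff_def)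
qed

lemma entire_coeff_euler:
  assumes "entire_coeff x"
  shows "entire_coeff (\<lambda>k. (\<mu> + 2 * real k) * x k)"
    and "eval_fps (real_fps (\<lambda>k. (\<mu> + 2 * real k) * x k)) z =
      of_real \<mu> * eval_fps (real_fps x) z + 2 * z * eval_fps (fps_deriv (real_fps x)) (z :: complex)"
proof -
  define y where "y = (\<lambda>k. real k * x k)"
  have ey: "(real_fps y :: complex fps) = fps_X * fps_deriv (real_fps x)"
  proof (rule fps_ext)
    fix n show "fps_nth (real_fps y) n = fps_nth (fps_X * fps_deriv (real_fps x)) n"
      by (cases n) (auto simp: y_def)
  qed
  have d: "fps_conv_radius (fps_deriv (real_fps x :: complex fps)) = \<infinity>"
    using fps_conv_radius_deriv[of "real_fps x :: complex fps"] assms by (simp add: entire_coeff_def)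
  have y: "entire_coeff y"
    using fps_conv_radius_mult[of fps_X "fps_deriv (real_fps x :: complex fps)"] d
    by (simp add: entire_coeff_def ey)
  have e: "(\<lambda>k. (\<mu> + 2 * real k) * x k) = (\<lambda>k. \<mu> * x k + 2 * y k)"
    by (auto simp: y_def algebra_simps)
  show "entire_coeff (\<lambda>k. (\<mu> + 2 * real k) * x k)"
    unfolding e by (rule entire_coeff_lincomb[OF assms y])
  show "eval_fps (real_fps (\<lambda>k. (\<mu> + 2 * real k) * x k)) z =
      of_real \<mu> * eval_fps (real_fps x) z + 2 * z * eval_fps (fps_deriv (real_fps x)) z"
    unfolding e entire_coeff_lincomb(2)[OF assms y] using d by (simp add: ey eval_fps_mult)
qed

lemma has_field_derivative_powr_mult_even:
  assumes x: "entire_coeff x" and z: "Re z > 0"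
  shows "((\<lambda>z. z powr of_real \<mu> * eval_fps (real_fps x) (z ^ 2)) has_field_derivative
    z powr of_real (\<mu> - 1) * eval_fps (real_fps (\<lambda>k. (\<mu> + 2 * real k) * x k)) (z ^ 2)) (at z)"
proof -
  have nz: "z \<noteq> 0" "z \<notin> \<real>\<^sub>\<le>\<^sub>0" using z by (auto simp: complex_nonpos_Reals_iff)
  have d1: "((\<lambda>z. z powr of_real \<mu>) has_field_derivative of_real \<mu> * z powr (of_real \<mu> - 1)) (at z)"
    by (rule has_field_derivative_powr[OF nz(2)])
  have "(eval_fps (real_fps x) has_field_derivative eval_fps (fps_deriv (real_fps x)) (z ^ 2)) (at (z ^ 2))"
    using x by (intro has_field_derivative_eval_fps) (simp add: entire_coeff_def)
  hence d2: "((\<lambda>z. eval_fps (real_fps x) (z ^ 2)) has_field_derivative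
      eval_fps (fps_deriv (real_fps x)) (z ^ 2) * (2 * z)) (at z)"
    by (rule DERIV_chain2) (auto intro!: derivative_eq_intros)
  have p: "z powr of_real \<mu> = z powr (of_real \<mu> - 1) * z"
    using nz by (simp add: powr_diff)
  show ?thesis
    unfolding entire_coeff_euler(2)[OF x]
    by (rule DERIV_cong[OF DERIV_mult[OF d1 d2]]) (simp add: p power2_eq_square algebra_simps)
qed

lemma entire_bessel_coeff:
  assumes "\<nu> > -1"
  shows "entire_coeff (bessel_coeff \<nu>)"
proof -
  obtain A where A: "\<And>n. \<forall>r\<in>#A n. r > 0"
    "\<And>k. (\<lambda>n. coeff (pos_prod (A n)) k) \<longlonglongrightarrow> of_real (bessel_coeff \<nu> k)"
    using pos_limit_bessel[OF assms] by (auto simp: pos_limit_def)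
  interpret positive_root_approximation A "bessel_coeff \<nu>"
    by unfold_locales (use A in auto)
  show ?thesis unfolding entire_coeff_def by (rule conv_radius)
qed

definition bessel_scale :: "real \<Rightarrow> real" where
  "bessel_scale \<nu> = 1 / (2 powr \<nu> * Gamma (\<nu> + 1))"

lemma bessel_J_eq:
  assumes \<nu>: "\<nu> > -1" and z: "Re z > 0"
  shows "bessel_J \<nu> z = of_real (bessel_scale \<nu>) * (z powr of_real \<nu> * eval_fps (real_fps (bessel_coeff \<nu>)) (z ^ 2))"
proof -
  have nz: "z \<noteq> 0" using z by auto
  have pw: "(if \<nu> = 0 then 1 else (z / 2) powr of_real \<nu>) = z powr of_real \<nu> / of_real (2 powr \<nu>)"
  proof -
    have "(z / 2) powr of_real \<nu> = (of_real (1 / 2) * z) powr of_real \<nu>" by simp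
    also have "\<dots> = of_real (1 / 2) powr of_real \<nu> * z powr of_real \<nu>"
      by (rule powr_times_real_left) auto
    also have "complex_of_real (1 / 2) powr of_real \<nu> = of_real ((1 / 2) powr \<nu>)"
      by (rule powr_of_real) auto
    also have "(1 / 2) powr \<nu> = 1 / 2 powr \<nu>" by (simp add: powr_divide)
    finally show ?thesis using nz by simp
  qed
  have Gam: "Gamma (real n + \<nu> + 1) = pochhammer (\<nu> + 1) n * Gamma (\<nu> + 1)" for n
  proof -
    have "\<nu> + 1 \<notin> \<int>\<^sub>\<le>\<^sub>0" using \<nu> by (auto elim!: nonpos_Ints_cases)
    hence "pochhammer (\<nu> + 1) n = Gamma (\<nu> + 1 + real n) / Gamma (\<nu> + 1)"
      by (rule pochhammer_Gamma)
    moreover have "Gamma (\<nu> + 1) > 0" using \<nu> by (intro Gamma_real_pos) simp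
    ultimately show ?thesis by (simp add: add_ac)
  qed
  have trm: "of_real ((-1) ^ n / (fact n * Gamma (real n + \<nu> + 1))) *
          ((z / 2) ^ (2 * n) * (if \<nu> = 0 then 1 else (z / 2) powr of_real \<nu>)) =
      of_real (bessel_scale \<nu>) * z powr of_real \<nu> * (of_real (bessel_coeff \<nu> n) * (z ^ 2) ^ n)" for n
  proof -
    have "(z / 2) ^ (2 * n) = (z ^ 2) ^ n / 4 ^ n"
      unfolding power_mult by (simp add: power_divide)
    thus ?thesis unfolding pw Gam bessel_scale_def bessel_coeff_def
      by (simp add: mult_ac)
  qed
  have "summable (\<lambda>n. of_real (bessel_coeff \<nu> n) * (z ^ 2) ^ n)"
    using summable_fps[of "z ^ 2" "real_fps (bessel_coeff \<nu>)"] entire_bessel_coeff[OF \<nu>]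
    by (simp add: entire_coeff_def)
  thus ?thesis unfolding bessel_J_def trm
    by (subst suminf_mult) (simp_all add: eval_fps_def mult_ac)
qed

lemma bessel_J_deriv_eq:
  assumes \<nu>: "\<nu> > -1" and z: "Re z > 0"
  shows "entire_coeff (\<lambda>k. (\<Prod>i<m. \<nu> + 2 * real k - real i) * bessel_coeff \<nu> k) \<and>
    bessel_J_deriv m \<nu> z = of_real (bessel_scale \<nu>) * (z powr of_real (\<nu> - real m) *
      eval_fps (real_fps (\<lambda>k. (\<Prod>i<m. \<nu> + 2 * real k - real i) * bessel_coeff \<nu> k)) (z ^ 2))"
  using z
proof (induction m arbitrary: z)
  case 0
  thus ?case using entire_bessel_coeff[OF \<nu>] bessel_J_eq[OF \<nu>] by simp
next
  case (Suc m)
  let ?x = "\<lambda>m k. (\<Prod>i<m. \<nu> + 2 * real k - real i) * bessel_coeff \<nu> k"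
  have x: "entire_coeff (?x m)" using Suc by blast
  have next_x: "(\<lambda>k. ((\<nu> - real m) + 2 * real k) * ?x m k) = ?x (Suc m)"
    by (auto simp: algebra_simps)
  have "((\<lambda>z. z powr of_real (\<nu> - real m) * eval_fps (real_fps (?x m)) (z ^ 2)) has_field_derivative
      z powr of_real (\<nu> - real m - 1) * eval_fps (real_fps (?x (Suc m))) (z ^ 2)) (at z)"
    using has_field_derivative_powr_mult_even[OF x Suc.prems, of "\<nu> - real m"] unfolding next_x .
  hence "((\<lambda>z. of_real (bessel_scale \<nu>) * (z powr of_real (\<nu> - real m) * eval_fps (real_fps (?x m)) (z ^ 2)))
      has_field_derivative of_real (bessel_scale \<nu>) *
      (z powr of_real (\<nu> - real m - 1) * eval_fps (real_fps (?x (Suc m))) (z ^ 2))) (at z)"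
    by (rule DERIV_cmult)
  hence "(bessel_J_deriv m \<nu> has_field_derivative of_real (bessel_scale \<nu>) *
      (z powr of_real (\<nu> - real m - 1) * eval_fps (real_fps (?x (Suc m))) (z ^ 2))) (at z)"
    by (rule has_field_derivative_transform_within_open[OF _ open_halfspace_Re_gt[of 0]])
      (use Suc in auto)
  hence "bessel_J_deriv (Suc m) \<nu> z = of_real (bessel_scale \<nu>) *
      (z powr of_real (\<nu> - real m - 1) * eval_fps (real_fps (?x (Suc m))) (z ^ 2))"
    by (simp add: DERIV_imp_deriv)
  moreover have "entire_coeff (?x (Suc m))"
    using entire_coeff_euler(1)[OF x, of "\<nu> - real m"] unfolding next_x .
  ultimately show ?case by (simp add: algebra_simps)
qed

lemma power_mult_bessel_J_deriv:
  assumes \<nu>: "\<nu> > -1" and z: "Re z > 0"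
  shows "z ^ m * bessel_J_deriv m \<nu> z = of_real (bessel_scale \<nu>) * (z powr of_real \<nu> *
      eval_fps (real_fps (\<lambda>k. (\<Prod>i<m. \<nu> + 2 * real k - real i) * bessel_coeff \<nu> k)) (z ^ 2))"
proof -
  have nz: "z \<noteq> 0" using z by auto
  have "z powr of_real \<nu> = z ^ m * z powr of_real (\<nu> - real m)"
    using nz by (simp add: powr_diff powr_nat')
  thus ?thesis using bessel_J_deriv_eq[OF assms, of m] by (simp add: mult_ac)
qed

text \<open>
  With \<open>t = \<nu> + 2 k\<close>, the second combination has the symbol
  \<open>a t (t - 1) (t - 2) + (2 a + b) t (t - 1) + (b + c) t = t Q(t)\<close>; it is \<open>z N\<^sub>\<nu>'(z)\<close>.
\<close>
lemma bessel_combination_series: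
  fixes a b c \<nu> :: real
  assumes \<nu>: "\<nu> > -1" and z: "Re z > 0" and Q: "Q_poly a b c \<nu> \<noteq> 0"
  defines "K \<equiv> of_real (bessel_scale \<nu> * Q_poly a b c \<nu>) * z powr of_real \<nu>"
    and "F \<equiv> real_fps (N_coeff a b c \<nu>) :: complex fps"
  shows "of_real a * (z ^ 2 * bessel_J_deriv 2 \<nu> z) + of_real b * (z * bessel_J_deriv 1 \<nu> z)
      + of_real c * bessel_J \<nu> z = K * eval_fps F (z ^ 2)" (is ?G1)
    and "of_real a * (z ^ 3 * bessel_J_deriv 3 \<nu> z) + of_real (2 * a + b) * (z ^ 2 * bessel_J_deriv 2 \<nu> z)
      + of_real (b + c) * (z * bessel_J_deriv 1 \<nu> z) =
      K * (of_real \<nu> * eval_fps F (z ^ 2) + 2 * z ^ 2 * eval_fps (fps_deriv F) (z ^ 2))" (is ?G2)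
proof -
  let ?x = "\<lambda>m k. (\<Prod>i<m. \<nu> + 2 * real k - real i) * bessel_coeff \<nu> k"
  let ?E = "\<lambda>m. eval_fps (real_fps (?x m)) (z ^ 2)"
  let ?N = "N_coeff a b c \<nu>"
  have x: "entire_coeff (?x m)" for m using bessel_J_deriv_eq[OF \<nu> z, of m] by blast
  have J: "z ^ m * bessel_J_deriv m \<nu> z = of_real (bessel_scale \<nu>) * (z powr of_real \<nu> * ?E m)" for m
    by (rule power_mult_bessel_J_deriv[OF \<nu> z])
  note lc = entire_coeff_lincomb
  have QN: "Q_poly a b c \<nu> * ?N k = Q_poly a b c (\<nu> + 2 * real k) * bessel_coeff \<nu> k" for k
    using Q by (simp add: N_coeff_def)
  have e1: "Q_poly a b c \<nu> * ?N k = 1 * (a * ?x 2 k + b * ?x 1 k) + c * ?x 0 k" for k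
    unfolding QN by (simp add: Q_poly_def numeral_2_eq_2 algebra_simps)
  have N': "(\<lambda>k. inverse (Q_poly a b c \<nu>) * (1 * (a * ?x 2 k + b * ?x 1 k) + c * ?x 0 k) + 0 * ?x 0 k) = ?N"
    unfolding e1[symmetric] using Q by (simp flip: mult.assoc)
  have entN: "entire_coeff ?N"
    unfolding N'[symmetric] by (intro lc(1) x)
  have e1': "(\<lambda>k. Q_poly a b c \<nu> * ?N k + 0 * ?x 0 k) = (\<lambda>k. 1 * (a * ?x 2 k + b * ?x 1 k) + c * ?x 0 k)"
    unfolding e1 by simp
  have "of_real (Q_poly a b c \<nu>) * eval_fps F (z ^ 2) =
      of_real a * ?E 2 + of_real b * ?E 1 + of_real c * ?E 0"
    using arg_cong[OF e1', of "\<lambda>x. eval_fps (real_fps x) (z ^ 2)"]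
    unfolding F_def by (simp only: lc x entN) simp
  note E1 = this
  have K: "K * w = of_real (bessel_scale \<nu>) * (z powr of_real \<nu> * (of_real (Q_poly a b c \<nu>) * w))" for w
    by (simp add: K_def)
  have J0: "bessel_J \<nu> z = of_real (bessel_scale \<nu>) * (z powr of_real \<nu> * ?E 0)"
    and J1: "z * bessel_J_deriv 1 \<nu> z = of_real (bessel_scale \<nu>) * (z powr of_real \<nu> * ?E 1)"
    using J[of 0] J[of 1] by (simp_all only: power_0 power_one_right mult_1_left funpow_0)
  show ?G1
    unfolding K E1 J J0 J1 by (simp only: ring_distribs mult_ac add_ac)
  let ?M = "\<lambda>k. (\<nu> + 2 * real k) * ?N k"
  have entM: "entire_coeff ?M" by (rule entire_coeff_euler[OF entN])
  have QM: "Q_poly a b c \<nu> * ?M k = (\<nu> + 2 * real k) * (Q_poly a b c \<nu> * ?N k)" for k by simp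
  have e2: "Q_poly a b c \<nu> * ?M k = 1 * (a * ?x 3 k + (2 * a + b) * ?x 2 k) + (b + c) * ?x 1 k" for k
    unfolding QM QN by (simp add: Q_poly_def numeral_2_eq_2 numeral_3_eq_3 algebra_simps)
  have e2': "(\<lambda>k. Q_poly a b c \<nu> * ?M k + 0 * ?x 0 k) =
      (\<lambda>k. 1 * (a * ?x 3 k + (2 * a + b) * ?x 2 k) + (b + c) * ?x 1 k)"
    unfolding e2 by simp
  have E2: "of_real (Q_poly a b c \<nu>) * (of_real \<nu> * eval_fps F (z ^ 2) + 2 * z ^ 2 * eval_fps (fps_deriv F) (z ^ 2)) =
      of_real a * ?E 3 + of_real (2 * a + b) * ?E 2 + of_real (b + c) * ?E 1"
    using arg_cong[OF e2', of "\<lambda>x. eval_fps (real_fps x) (z ^ 2)"] entire_coeff_euler(2)[OF entN, of \<nu> "z ^ 2"]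
    unfolding F_def by (simp only: lc x entM) simp
  show ?G2
    unfolding K E2 J J1 by (simp only: ring_distribs mult_ac add_ac)
qed

section \<open>Identification of the normalised functions\<close>

lemma bessel_scale_pos: "\<nu> > -1 \<Longrightarrow> bessel_scale \<nu> > 0"
  using Gamma_real_pos[of "\<nu> + 1"] by (simp add: bessel_scale_def)

lemma norm_const_mult_bessel_N:
  assumes \<nu>: "\<nu> > -1" and z: "Re z > 0" and Q: "Q_poly a b c \<nu> \<noteq> 0"
  shows "norm_const a b c \<nu> * bessel_N a b c \<nu> z =
    z powr of_real \<nu> * eval_fps (real_fps (N_coeff a b c \<nu>)) (z ^ 2)"
proof -
  let ?E = "eval_fps (real_fps (N_coeff a b c \<nu>)) (z ^ 2)"
  have N: "bessel_N a b c \<nu> z = of_real (bessel_scale \<nu> * Q_poly a b c \<nu>) * z powr of_real \<nu> * ?E"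
    using bessel_combination_series(1)[OF assms] unfolding bessel_N_def mult.assoc .
  have "Gamma (\<nu> + 1) > 0" using \<nu> by (intro Gamma_real_pos) simp
  hence "2 powr \<nu> * Gamma (\<nu> + 1) / Q_poly a b c \<nu> * (bessel_scale \<nu> * Q_poly a b c \<nu>) = 1"
    using Q by (simp add: bessel_scale_def)
  hence "norm_const a b c \<nu> * of_real (bessel_scale \<nu> * Q_poly a b c \<nu>) = 1"
    unfolding norm_const_def by (metis of_real_1 of_real_mult)
  thus ?thesis unfolding N by (metis mult.assoc mult_1)
qed

text \<open>
  Raising \<open>z exp (l(z) / \<nu>)\<close> to the power \<open>\<nu>\<close> gives \<open>z\<^sup>\<nu> exp (l(z)) = z\<^sup>\<nu> \<Phi>(z\<^sup>2)\<close>, without a change of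
  branch close to \<open>0\<close>.
\<close>
lemma f_fps_eqI:
  assumes \<nu>: "\<nu> > -1" "\<nu> \<noteq> 0" and Q: "Q_poly a b c \<nu> \<noteq> 0"
    and F: "fps_conv_radius F > 0" "fps_nth F 0 = 0" "fps_nth F 1 = 1"
    and l: "(l \<longlongrightarrow> 0) (nhds 0)"
    and eval: "\<forall>\<^sub>F z in nhds 0. eval_fps (real_fps (N_coeff a b c \<nu>)) (z ^ 2) = exp (l z) \<and>
      eval_fps F z = z * exp (of_real (1 / \<nu>) * l z)"
  shows "f_fps a b c \<nu> = F"
proof -
  have "((\<lambda>z. \<bar>Im (of_real (1 / \<nu>) * l z)\<bar>) \<longlongrightarrow> 0) (nhds 0)"
    using tendsto_rabs[OF tendsto_Im[OF tendsto_mult[OF tendsto_const l]], of "of_real (1 / \<nu>)"]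
    by simp
  hence "\<forall>\<^sub>F z in nhds 0. \<bar>Im (of_real (1 / \<nu>) * l z)\<bar> < pi / 2"
    by (rule order_tendstoD) simp
  from eventually_nhds_imp_half_plane[OF eventually_conj[OF this eval]]
  have ev: "\<forall>\<^sub>F z in at 0 within half_plane.
      eval_fps F z powr of_real \<nu> = norm_const a b c \<nu> * bessel_N a b c \<nu> z"
  proof eventually_elim
    case (elim z)
    have "eval_fps F z powr of_real \<nu> = z powr of_real \<nu> * exp (of_real \<nu> * (of_real (1 / \<nu>) * l z))"
      using elim powr_mult_exp_half_plane by metis
    also have "of_real \<nu> * (of_real (1 / \<nu>) * l z) = l z" using \<nu> by simp
    finally show ?case
      using elim norm_const_mult_bessel_N[OF \<nu>(1) _ Q, of z] by simp
  qed
  show ?thesis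
    unfolding f_fps_def
  proof (rule the_equality)
    fix G assume G: "fps_conv_radius G > 0 \<and> fps_nth G 0 = 0 \<and> fps_nth G 1 = 1 \<and>
      (\<forall>\<^sub>F z in at 0 within half_plane. eval_fps G z powr of_real \<nu> = norm_const a b c \<nu> * bessel_N a b c \<nu> z)"
    hence "\<forall>\<^sub>F z in at 0 within half_plane. eval_fps G z powr of_real \<nu> = norm_const a b c \<nu> * bessel_N a b c \<nu> z"
      by blast
    with ev have "\<forall>\<^sub>F z in at 0 within half_plane. eval_fps G z powr of_real \<nu> = eval_fps F z powr of_real \<nu>"
      by eventually_elim simp
    thus "G = F" using G F \<nu>(2) by (intro powr_branch_unique) auto
  qed (use F ev in auto)
qed

lemma the_fps_eqI:
  fixes F :: "complex fps"
  assumes F: "fps_conv_radius F > 0"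
    and ev: "\<forall>\<^sub>F z in at 0 within half_plane. eval_fps F z = f z"
  shows "(THE F. fps_conv_radius F > 0 \<and> (\<forall>\<^sub>F z in at 0 within half_plane. eval_fps F z = f z)) = F"
proof (rule the_equality)
  fix G :: "complex fps"
  assume G: "fps_conv_radius G > 0 \<and> (\<forall>\<^sub>F z in at 0 within half_plane. eval_fps G z = f z)"
  hence "\<forall>\<^sub>F z in at 0 within half_plane. eval_fps G z = f z" by blast
  with ev have "\<forall>\<^sub>F z in at 0 within half_plane. eval_fps G z = eval_fps F z"
    by eventually_elim simp
  thus "G = F" using G F by (intro fps_eq_if_eval_eq_half_plane) auto
qed (use F ev in auto)

lemma g_fps_eqI:
  assumes \<nu>: "\<nu> > -1" and Q: "Q_poly a b c \<nu> \<noteq> 0"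
    and F: "fps_conv_radius F > 0"
    and eval: "\<forall>\<^sub>F z in nhds 0. eval_fps F z = z * eval_fps (real_fps (N_coeff a b c \<nu>)) (z ^ 2)"
  shows "g_fps a b c \<nu> = F"
  unfolding g_fps_def
proof (rule the_fps_eqI[OF F])
  show "\<forall>\<^sub>F z in at 0 within half_plane.
      eval_fps F z = norm_const a b c \<nu> * z powr of_real (1 - \<nu>) * bessel_N a b c \<nu> z"
    using eventually_nhds_imp_half_plane[OF eval]
  proof eventually_elim
    case (elim z)
    have "z \<noteq> 0" using elim by auto
    hence "z = z powr of_real (1 - \<nu>) * z powr of_real \<nu>" by (simp flip: powr_add)
    thus ?case
      using elim norm_const_mult_bessel_N[OF \<nu> _ Q, of z] by (metis mult.assoc mult.commute)
  qed
qed

text \<open>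
  For \<open>Re z > 0\<close> the root \<open>csqrt z\<close> is again in the right half-plane, and
  \<open>(csqrt z)\<^sup>\<nu> = z\<^sup>\<nu>\<^sup>/\<^sup>2\<close> for principal branches.
\<close>
lemma h_fps_eqI:
  assumes \<nu>: "\<nu> > -1" and Q: "Q_poly a b c \<nu> \<noteq> 0"
    and F: "fps_conv_radius F > 0"
    and eval: "\<forall>\<^sub>F z in nhds 0. eval_fps F z = z * eval_fps (real_fps (N_coeff a b c \<nu>)) z"
  shows "h_fps a b c \<nu> = F"
  unfolding h_fps_def
proof (rule the_fps_eqI[OF F])
  show "\<forall>\<^sub>F z in at 0 within half_plane.
      eval_fps F z = norm_const a b c \<nu> * z powr of_real (1 - \<nu> / 2) * bessel_N a b c \<nu> (csqrt z)"
    using eventually_nhds_imp_half_plane[OF eval]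
  proof eventually_elim
    case (elim z)
    have nz: "z \<noteq> 0" using elim by auto
    have c_exp: "csqrt z = exp (Ln z / 2)" using nz by (rule csqrt_exp_Ln)
    have Im_Ln: "\<bar>Im (Ln z)\<bar> < pi / 2" using Re_Ln_pos_lt[OF nz] elim by blast
    have Ln_c: "Ln (csqrt z) = Ln z / 2"
      unfolding c_exp using Im_Ln by (intro Ln_exp) auto
    have "Im (Ln (csqrt z)) = Im (Ln z) / 2" unfolding Ln_c by simp
    hence "\<bar>Im (Ln (csqrt z))\<bar> < pi / 2" using Im_Ln by simp
    hence Re_c: "Re (csqrt z) > 0" using Re_Ln_pos_lt[of "csqrt z"] nz by simp
    have c_powr: "csqrt z powr of_real \<nu> = z powr of_real (\<nu> / 2)"
      using nz by (simp add: powr_def Ln_c)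
    have zz: "z = z powr of_real (1 - \<nu> / 2) * z powr of_real (\<nu> / 2)"
      using nz by (simp flip: powr_add)
    have "norm_const a b c \<nu> * bessel_N a b c \<nu> (csqrt z) =
        z powr of_real (\<nu> / 2) * eval_fps (real_fps (N_coeff a b c \<nu>)) z"
      using norm_const_mult_bessel_N[OF \<nu> Re_c Q] by (simp add: c_powr)
    thus ?case using elim zz by (metis mult.assoc mult.commute)
  qed
qed

text \<open>
  The equations for \<open>g\<close> and \<open>h\<close> are quotients of the two Bessel combinations; clearing the denominator
  leaves the equation \<open>w \<Phi>' + L \<Phi> = 0\<close> that defines the radius.
\<close>
lemma quotient_equation_iff:
  fixes K \<Phi> \<Phi>' w :: complex
  assumes "K \<noteq> 0" "\<Phi> \<noteq> 0"
  shows "of_real (s - \<nu>) + K * (of_real \<nu> * \<Phi> + 2 * w * \<Phi>') / (K * \<Phi>) = of_real t \<longleftrightarrow>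
    w * \<Phi>' + of_real ((s - t) / 2) * \<Phi> = 0"
proof -
  have "of_real (s - \<nu>) + K * (of_real \<nu> * \<Phi> + 2 * w * \<Phi>') / (K * \<Phi>) - of_real t =
      2 / \<Phi> * (w * \<Phi>' + of_real ((s - t) / 2) * \<Phi>)"
    using assms by (simp add: field_simps)
  thus ?thesis using assms(2)
    by (metis divide_eq_0_iff eq_iff_diff_eq_0 mult_eq_0_iff zero_neq_numeral)
qed

section \<open>Radii of starlikeness\<close>

theorem theorem2p1:
  fixes a b c \<beta> \<nu> :: real
  assumes "0 \<le> \<beta>" and "\<beta> < 1"
    and "(c = 0 \<and> a \<noteq> b) \<or> (c > 0 \<and> a < b)"
    and "Q_poly a b c \<nu> \<noteq> 0"
  shows
    "(\<nu> \<ge> nu_bound a b c \<and> \<nu> \<noteq> 0 \<longrightarrow>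
       (\<exists>\<rho>. starlike_radius \<beta> (f_fps a b c \<nu>) = ereal \<rho> \<and>
         smallest_positive_root (\<lambda>r.
           complex_of_real (a * r ^ 3) * bessel_J_deriv 3 \<nu> (complex_of_real r)
           + complex_of_real ((2 * a + b - a * \<nu> * \<beta>) * r ^ 2)
               * bessel_J_deriv 2 \<nu> (complex_of_real r)
           + complex_of_real ((b + c - b * \<nu> * \<beta>) * r) * bessel_J_deriv 1 \<nu> (complex_of_real r)
           - complex_of_real (c * \<nu> * \<beta>) * bessel_J \<nu> (complex_of_real r) = 0) \<rho>))
     \<and> (\<nu> \<ge> nu_bound a b c \<longrightarrow>
       (\<exists>\<rho>. starlike_radius \<beta> (g_fps a b c \<nu>) = ereal \<rho> \<and>
         smallest_positive_root (\<lambda>r.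
           bessel_N a b c \<nu> (complex_of_real r) \<noteq> 0 \<and>
           complex_of_real (1 - \<nu>)
           + (complex_of_real (a * r ^ 3) * bessel_J_deriv 3 \<nu> (complex_of_real r)
              + complex_of_real ((2 * a + b) * r ^ 2) * bessel_J_deriv 2 \<nu> (complex_of_real r)
              + complex_of_real ((b + c) * r) * bessel_J_deriv 1 \<nu> (complex_of_real r))
             / (complex_of_real (a * r ^ 2) * bessel_J_deriv 2 \<nu> (complex_of_real r)
                + complex_of_real (b * r) * bessel_J_deriv 1 \<nu> (complex_of_real r)
                + complex_of_real c * bessel_J \<nu> (complex_of_real r))
           = complex_of_real \<beta>) \<rho>))
     \<and> (\<nu> \<ge> nu_bound a b c \<longrightarrow>
       (\<exists>\<rho>. starlike_radius \<beta> (h_fps a b c \<nu>) = ereal \<rho> \<and>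
         smallest_positive_root (\<lambda>r.
           bessel_N a b c \<nu> (complex_of_real (sqrt r)) \<noteq> 0 \<and>
           complex_of_real (2 - \<nu>)
           + (complex_of_real (a * r * sqrt r) * bessel_J_deriv 3 \<nu> (complex_of_real (sqrt r))
              + complex_of_real ((2 * a + b) * r) * bessel_J_deriv 2 \<nu> (complex_of_real (sqrt r))
              + complex_of_real ((b + c) * sqrt r)
                  * bessel_J_deriv 1 \<nu> (complex_of_real (sqrt r)))
             / (complex_of_real (a * r) * bessel_J_deriv 2 \<nu> (complex_of_real (sqrt r))
                + complex_of_real (b * sqrt r) * bessel_J_deriv 1 \<nu> (complex_of_real (sqrt r))
                + complex_of_real c * bessel_J \<nu> (complex_of_real (sqrt r)))
           = complex_of_real (2 * \<beta>)) \<rho>))"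
proof (cases "\<nu> \<ge> nu_bound a b c")
  case True
  note \<beta> = assms(2) and par = assms(3) and Q = assms(4)
  have \<nu>0: "\<nu> \<ge> 0" using True nu_bound_ge_0[of a b c] by linarith
  hence \<nu>1: "\<nu> > -1" by simp
  let ?\<Phi> = "eval_fps (real_fps (N_coeff a b c \<nu>) :: complex fps)"
  let ?\<Phi>' = "eval_fps (fps_deriv (real_fps (N_coeff a b c \<nu>)) :: complex fps)"
  let ?J = "\<lambda>m z. bessel_J_deriv m \<nu> z"
  define K where "K = (\<lambda>z. of_real (bessel_scale \<nu> * Q_poly a b c \<nu>) * z powr complex_of_real \<nu>)"
  have K: "K z \<noteq> 0" if "Re z > 0" for z
    using bessel_scale_pos[OF \<nu>1] Q that by (auto simp: K_def)
  have eqN: "of_real a * (z ^ 2 * ?J 2 z) + of_real b * (z * ?J 1 z) + of_real c * bessel_J \<nu> z =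
      K z * ?\<Phi> (z ^ 2)" if "Re z > 0" for z
    unfolding K_def by (rule bessel_combination_series(1)[OF \<nu>1 that Q])
  have eqD: "of_real a * (z ^ 3 * ?J 3 z) + of_real (2 * a + b) * (z ^ 2 * ?J 2 z)
      + of_real (b + c) * (z * ?J 1 z) =
      K z * (of_real \<nu> * ?\<Phi> (z ^ 2) + 2 * z ^ 2 * ?\<Phi>' (z ^ 2))" if "Re z > 0" for z
    unfolding K_def by (rule bessel_combination_series(2)[OF \<nu>1 that Q])
  have N_eq: "bessel_N a b c \<nu> z = K z * ?\<Phi> (z ^ 2)" if "Re z > 0" for z
    using eqN[OF that] unfolding bessel_N_def mult.assoc .
  note core = starlike_radius_power_exp[OF pos_limit_N_coeff[OF par Q True] N_coeff_0[OF Q] N_coeff_1_neg[OF Q True] \<beta>]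
  have "\<exists>\<rho>. starlike_radius \<beta> (f_fps a b c \<nu>) = ereal \<rho> \<and>
         smallest_positive_root (\<lambda>r.
           complex_of_real (a * r ^ 3) * bessel_J_deriv 3 \<nu> (complex_of_real r)
           + complex_of_real ((2 * a + b - a * \<nu> * \<beta>) * r ^ 2)
               * bessel_J_deriv 2 \<nu> (complex_of_real r)
           + complex_of_real ((b + c - b * \<nu> * \<beta>) * r) * bessel_J_deriv 1 \<nu> (complex_of_real r)
           - complex_of_real (c * \<nu> * \<beta>) * bessel_J \<nu> (complex_of_real r) = 0) \<rho>"
    (is "\<exists>\<rho>. _ \<and> smallest_positive_root ?E \<rho>") if "\<nu> \<noteq> 0"
  proof -
    have \<kappa>: "1 / \<nu> > 0" using \<nu>0 that by simp
    obtain F R l where F: "0 < R" "starlike_radius \<beta> F = ereal R"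
      "fps_conv_radius F > 0" "fps_nth F 0 = 0" "fps_nth F 1 = 1" "(l \<longlongrightarrow> 0) (nhds 0)"
      "\<forall>\<^sub>F z in nhds 0. ?\<Phi> (z ^ 2) = exp (l z) \<and> eval_fps F z = z * exp (of_real (1 / \<nu>) * l z)"
      "of_real (R ^ 2) * ?\<Phi>' (of_real (R ^ 2)) + of_real ((1 - \<beta>) / (1 / \<nu> * real 2)) * ?\<Phi> (of_real (R ^ 2)) = 0"
      "\<And>s. s > 0 \<Longrightarrow> of_real (s ^ 2) * ?\<Phi>' (of_real (s ^ 2))
        + of_real ((1 - \<beta>) / (1 / \<nu> * real 2)) * ?\<Phi> (of_real (s ^ 2)) = 0 \<Longrightarrow> R \<le> s"
      by (rule core[OF \<kappa> pos2]) blast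
    have f: "f_fps a b c \<nu> = F" by (rule f_fps_eqI[OF \<nu>1 that Q F(3-7)])
    \<comment> \<open>the equation is \<open>z N'(z) - \<nu> \<beta> N(z) = 0\<close>, and \<open>N\<close> is \<open>K(z) \<Phi>(z\<^sup>2)\<close> with \<open>K(z)\<close> a multiple of \<open>z\<^sup>\<nu>\<close>\<close>
    have E: "?E r \<longleftrightarrow> of_real (r ^ 2) * ?\<Phi>' (of_real (r ^ 2))
        + of_real ((1 - \<beta>) / (1 / \<nu> * real 2)) * ?\<Phi> (of_real (r ^ 2)) = 0" if "r > 0" for r
    proof -
      define z where "z = complex_of_real r"
      have z: "Re z > 0" using that by (simp add: z_def)
      have "complex_of_real (a * r ^ 3) * j3 + complex_of_real ((2 * a + b - a * \<nu> * \<beta>) * r ^ 2) * j2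
           + complex_of_real ((b + c - b * \<nu> * \<beta>) * r) * j1 - complex_of_real (c * \<nu> * \<beta>) * j0 =
         (of_real a * (z ^ 3 * j3) + of_real (2 * a + b) * (z ^ 2 * j2) + of_real (b + c) * (z * j1))
         - of_real (\<nu> * \<beta>) * (of_real a * (z ^ 2 * j2) + of_real b * (z * j1) + of_real c * j0)" for j0 j1 j2 j3
        by (simp add: z_def algebra_simps)
      hence "?E r \<longleftrightarrow> K z * (of_real \<nu> * ?\<Phi> (z ^ 2) + 2 * z ^ 2 * ?\<Phi>' (z ^ 2))
          - of_real (\<nu> * \<beta>) * (K z * ?\<Phi> (z ^ 2)) = 0"
        by (simp only: eqD[OF z] eqN[OF z] flip: z_def)
      also have "K z * (of_real \<nu> * ?\<Phi> (z ^ 2) + 2 * z ^ 2 * ?\<Phi>' (z ^ 2))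
          - of_real (\<nu> * \<beta>) * (K z * ?\<Phi> (z ^ 2)) =
          (2 * K z) * (z ^ 2 * ?\<Phi>' (z ^ 2) + of_real ((1 - \<beta>) / (1 / \<nu> * real 2)) * ?\<Phi> (z ^ 2))"
      proof -
        have L: "(1 - \<beta>) / (1 / \<nu> * real 2) = (\<nu> - \<nu> * \<beta>) / 2"
          by (simp add: field_simps)
        show ?thesis unfolding L by (simp add: field_simps)
      qed
      finally show ?thesis using K[OF z] by (simp add: z_def)
    qed
    show ?thesis unfolding f smallest_positive_root_def
      using F E by (intro exI[of _ R] conjI allI impI) blast+
  qed
  moreover have "\<exists>\<rho>. starlike_radius \<beta> (g_fps a b c \<nu>) = ereal \<rho> \<and>
         smallest_positive_root (\<lambda>r.
           bessel_N a b c \<nu> (complex_of_real r) \<noteq> 0 \<and>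
           complex_of_real (1 - \<nu>)
           + (complex_of_real (a * r ^ 3) * bessel_J_deriv 3 \<nu> (complex_of_real r)
              + complex_of_real ((2 * a + b) * r ^ 2) * bessel_J_deriv 2 \<nu> (complex_of_real r)
              + complex_of_real ((b + c) * r) * bessel_J_deriv 1 \<nu> (complex_of_real r))
             / (complex_of_real (a * r ^ 2) * bessel_J_deriv 2 \<nu> (complex_of_real r)
                + complex_of_real (b * r) * bessel_J_deriv 1 \<nu> (complex_of_real r)
                + complex_of_real c * bessel_J \<nu> (complex_of_real r))
           = complex_of_real \<beta>) \<rho>"
    (is "\<exists>\<rho>. _ \<and> smallest_positive_root ?E \<rho>")
  proof -
    obtain F R l where F: "0 < R" "starlike_radius \<beta> F = ereal R" "fps_conv_radius F > 0"
      "\<forall>\<^sub>F z in nhds 0. ?\<Phi> (z ^ 2) = exp (l z) \<and> eval_fps F z = z * exp (of_real 1 * l z)"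
      "?\<Phi> (of_real (R ^ 2)) \<noteq> 0"
      "of_real (R ^ 2) * ?\<Phi>' (of_real (R ^ 2)) + of_real ((1 - \<beta>) / (1 * real 2)) * ?\<Phi> (of_real (R ^ 2)) = 0"
      "\<And>s. s > 0 \<Longrightarrow> of_real (s ^ 2) * ?\<Phi>' (of_real (s ^ 2))
        + of_real ((1 - \<beta>) / (1 * real 2)) * ?\<Phi> (of_real (s ^ 2)) = 0 \<Longrightarrow> R \<le> s"
      by (rule core[OF zero_less_one pos2]) blast
    have g: "g_fps a b c \<nu> = F"
      by (rule g_fps_eqI[OF \<nu>1 Q F(3)]) (use F(4) in \<open>auto elim!: eventually_mono\<close>)
    have E: "?E r \<longleftrightarrow> ?\<Phi> (of_real (r ^ 2)) \<noteq> 0 \<and> of_real (r ^ 2) * ?\<Phi>' (of_real (r ^ 2))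
        + of_real ((1 - \<beta>) / (1 * real 2)) * ?\<Phi> (of_real (r ^ 2)) = 0" if "r > 0" for r
    proof -
      define z where "z = complex_of_real r"
      have z: "Re z > 0" using that by (simp add: z_def)
      have num: "complex_of_real (a * r ^ 3) * j3 + complex_of_real ((2 * a + b) * r ^ 2) * j2
           + complex_of_real ((b + c) * r) * j1 =
         of_real a * (z ^ 3 * j3) + of_real (2 * a + b) * (z ^ 2 * j2) + of_real (b + c) * (z * j1)"
        and den: "complex_of_real (a * r ^ 2) * j2 + complex_of_real (b * r) * j1 + complex_of_real c * j0 =
         of_real a * (z ^ 2 * j2) + of_real b * (z * j1) + of_real c * j0" for j0 j1 j2 j3
        by (simp_all add: z_def algebra_simps)
      have "?E r \<longleftrightarrow> K z * ?\<Phi> (z ^ 2) \<noteq> 0 \<and> of_real (1 - \<nu>) +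
          K z * (of_real \<nu> * ?\<Phi> (z ^ 2) + 2 * z ^ 2 * ?\<Phi>' (z ^ 2)) / (K z * ?\<Phi> (z ^ 2)) = of_real \<beta>"
        unfolding num den by (simp only: eqD[OF z] eqN[OF z] N_eq[OF z] flip: z_def)
      also have "\<dots> \<longleftrightarrow> ?\<Phi> (z ^ 2) \<noteq> 0 \<and>
          z ^ 2 * ?\<Phi>' (z ^ 2) + of_real ((1 - \<beta>) / 2) * ?\<Phi> (z ^ 2) = 0"
        using quotient_equation_iff[of "K z" "?\<Phi> (z ^ 2)" 1 \<nu> "z ^ 2" "?\<Phi>' (z ^ 2)" \<beta>] K[OF z] by auto
      finally show ?thesis by (simp add: z_def)
    qed
    show ?thesis unfolding g smallest_positive_root_def
      using F E by (intro exI[of _ R] conjI allI impI) blast+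
  qed
  moreover have "\<exists>\<rho>. starlike_radius \<beta> (h_fps a b c \<nu>) = ereal \<rho> \<and>
         smallest_positive_root (\<lambda>r.
           bessel_N a b c \<nu> (complex_of_real (sqrt r)) \<noteq> 0 \<and>
           complex_of_real (2 - \<nu>)
           + (complex_of_real (a * r * sqrt r) * bessel_J_deriv 3 \<nu> (complex_of_real (sqrt r))
              + complex_of_real ((2 * a + b) * r) * bessel_J_deriv 2 \<nu> (complex_of_real (sqrt r))
              + complex_of_real ((b + c) * sqrt r)
                  * bessel_J_deriv 1 \<nu> (complex_of_real (sqrt r)))
             / (complex_of_real (a * r) * bessel_J_deriv 2 \<nu> (complex_of_real (sqrt r))
                + complex_of_real (b * sqrt r) * bessel_J_deriv 1 \<nu> (complex_of_real (sqrt r))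
                + complex_of_real c * bessel_J \<nu> (complex_of_real (sqrt r)))
           = complex_of_real (2 * \<beta>)) \<rho>"
    (is "\<exists>\<rho>. _ \<and> smallest_positive_root ?E \<rho>")
  proof -
    obtain F R l where F: "0 < R" "starlike_radius \<beta> F = ereal R" "fps_conv_radius F > 0"
      "\<forall>\<^sub>F z in nhds 0. ?\<Phi> (z ^ 1) = exp (l z) \<and> eval_fps F z = z * exp (of_real 1 * l z)"
      "?\<Phi> (of_real (R ^ 1)) \<noteq> 0"
      "of_real (R ^ 1) * ?\<Phi>' (of_real (R ^ 1)) + of_real ((1 - \<beta>) / (1 * real 1)) * ?\<Phi> (of_real (R ^ 1)) = 0"
      "\<And>s. s > 0 \<Longrightarrow> of_real (s ^ 1) * ?\<Phi>' (of_real (s ^ 1))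
        + of_real ((1 - \<beta>) / (1 * real 1)) * ?\<Phi> (of_real (s ^ 1)) = 0 \<Longrightarrow> R \<le> s"
      by (rule core[OF zero_less_one zero_less_one]) blast
    have h: "h_fps a b c \<nu> = F"
      by (rule h_fps_eqI[OF \<nu>1 Q F(3)]) (use F(4) in \<open>auto elim!: eventually_mono\<close>)
    have E: "?E r \<longleftrightarrow> ?\<Phi> (of_real (r ^ 1)) \<noteq> 0 \<and> of_real (r ^ 1) * ?\<Phi>' (of_real (r ^ 1))
        + of_real ((1 - \<beta>) / (1 * real 1)) * ?\<Phi> (of_real (r ^ 1)) = 0" if "r > 0" for r
    proof -
      define z where "z = complex_of_real (sqrt r)"
      have z: "Re z > 0" using that by (simp add: z_def)
      have z2: "z ^ 2 = of_real r" using that by (simp add: z_def flip: of_real_power)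
      have z3: "z ^ 3 = of_real r * of_real (sqrt r)"
        using z2 by (simp add: z_def power3_eq_cube power2_eq_square)
      have num: "complex_of_real (a * r * sqrt r) * j3 + complex_of_real ((2 * a + b) * r) * j2
           + complex_of_real ((b + c) * sqrt r) * j1 =
         of_real a * (z ^ 3 * j3) + of_real (2 * a + b) * (z ^ 2 * j2) + of_real (b + c) * (z * j1)"
        and den: "complex_of_real (a * r) * j2 + complex_of_real (b * sqrt r) * j1 + complex_of_real c * j0 =
         of_real a * (z ^ 2 * j2) + of_real b * (z * j1) + of_real c * j0" for j0 j1 j2 j3
        unfolding z2 z3 by (simp_all add: z_def algebra_simps)
      have "?E r \<longleftrightarrow> K z * ?\<Phi> (z ^ 2) \<noteq> 0 \<and> of_real (2 - \<nu>) +
          K z * (of_real \<nu> * ?\<Phi> (z ^ 2) + 2 * z ^ 2 * ?\<Phi>' (z ^ 2)) / (K z * ?\<Phi> (z ^ 2)) = of_real (2 * \<beta>)"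
        unfolding num den by (simp only: eqD[OF z] eqN[OF z] N_eq[OF z] flip: z_def)
      also have "\<dots> \<longleftrightarrow> ?\<Phi> (z ^ 2) \<noteq> 0 \<and>
          z ^ 2 * ?\<Phi>' (z ^ 2) + of_real ((2 - 2 * \<beta>) / 2) * ?\<Phi> (z ^ 2) = 0"
        using quotient_equation_iff[of "K z" "?\<Phi> (z ^ 2)" 2 \<nu> "z ^ 2" "?\<Phi>' (z ^ 2)" "2 * \<beta>"] K[OF z] by auto
      also have "(2 - 2 * \<beta>) / 2 = (1 - \<beta>) / (1 * real 1)" by simp
      finally show ?thesis unfolding z2 power_one_right .
    qed
    show ?thesis unfolding h smallest_positive_root_def
      using F E by (intro exI[of _ R] conjI allI impI) blast+
  qed
  ultimately show ?thesis by blast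
qed blast

end
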